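(* Let $p$ be a prime and let $G$ be a finite $p$-group of nilpotency class at most $p-1$. Then $D(G)$ is nilpotent of class at most $p-1$, $\exp(D(G))$ divides $\exp(G)$, and $\exp(\chi(G))$ divides $\exp(G)^2$.
   Context: For a group $G$, let $G^{\varphi}$ be a copy of $G$, isomorphic to $G$ via $\varphi: G\to G^{\varphi}$, $g\mapsto g^{\varphi}$. The weak commutativity group of $G$ is $\chi(G)=\langle G\cup G^{\varphi}\mid [g,g^{\varphi}]=1 \text{ for all } g\in G\rangle$, i.e. the quotient of the free product $G * G^{\varphi}$ by the normal closure of all $[g,g^{\varphi}]$, $g\in G$; the groups $G$ and $G^{\varphi}$ are identified with their (isomorphic) images in $\chi(G)$. Commutators are $[x,y]=x^{-1}y^{-1}xy$. $D(G)=[G,G^{\varphi}]=\langle [g,h^{\varphi}]\mid g,h\in G\rangle\leq\chi(G)$. $\exp(X)$ denotes the exponent of a group $X$. *)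

theory Defs
  imports "HOL-Algebra.Algebra"
begin

section \<open>Commutators, lower central series, exponent\<close>

definition commutator :: "('a, 'm) monoid_scheme \<Rightarrow> 'a \<Rightarrow> 'a \<Rightarrow> 'a" where
  "commutator G x y = inv\<^bsub>G\<^esub> x \<otimes>\<^bsub>G\<^esub> inv\<^bsub>G\<^esub> y \<otimes>\<^bsub>G\<^esub> x \<otimes>\<^bsub>G\<^esub> y"

definition commutator_subgroup ::
    "('a, 'm) monoid_scheme \<Rightarrow> 'a set \<Rightarrow> 'a set \<Rightarrow> 'a set" where
  "commutator_subgroup G H K = generate G {commutator G h k | h k. h \<in> H \<and> k \<in> K}"

text \<open>Indexed from 0: \<open>lower_central G n\<close> is the term usually written \<open>\<gamma>\<^bsub>n+1\<^esub>(G)\<close>,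
  so that the class is the least \<open>n\<close> with \<open>lower_central G n = {\<one>}\<close>.\<close>

primrec lower_central :: "('a, 'm) monoid_scheme \<Rightarrow> nat \<Rightarrow> 'a set" where
  "lower_central G 0 = carrier G"
| "lower_central G (Suc n) = commutator_subgroup G (lower_central G n) (carrier G)"

definition nilpotent_group :: "('a, 'm) monoid_scheme \<Rightarrow> bool" where
  "nilpotent_group G \<longleftrightarrow> group G \<and> (\<exists>n. lower_central G n = {\<one>\<^bsub>G\<^esub>})"

text \<open>Only meaningful for nilpotent groups.\<close>

definition nilpotency_class :: "('a, 'm) monoid_scheme \<Rightarrow> nat" where
  "nilpotency_class G = (LEAST n. lower_central G n = {\<one>\<^bsub>G\<^esub>})"

text \<open>The value 0 encodes infinite exponent; as \<open>0\<close> divides only \<open>0\<close>, a statement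
  \<open>group_exponent X dvd n\<close> with \<open>n > 0\<close> includes that \<open>X\<close> has finite exponent.\<close>

definition group_exponent :: "('a, 'm) monoid_scheme \<Rightarrow> nat" where
  "group_exponent G =
    (if \<exists>n>0. \<forall>x\<in>carrier G. x [^]\<^bsub>G\<^esub> (n::nat) = \<one>\<^bsub>G\<^esub>
     then LEAST n. n > 0 \<and> (\<forall>x\<in>carrier G. x [^]\<^bsub>G\<^esub> (n::nat) = \<one>\<^bsub>G\<^esub>)
     else 0)"

definition finite_p_group :: "nat \<Rightarrow> ('a, 'm) monoid_scheme \<Rightarrow> bool" where
  "finite_p_group p G \<longleftrightarrow> group G \<and> finite (carrier G) \<and> (\<exists>n. order G = p ^ n)"

definition normal_closure :: "('a, 'm) monoid_scheme \<Rightarrow> 'a set \<Rightarrow> 'a set" where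
  "normal_closure G S = \<Inter>{N. N \<lhd> G \<and> S \<subseteq> N}"

lemma (in group) normal_closure_normal:
  assumes "S \<subseteq> carrier G"
  shows "normal_closure G S \<lhd> G"
proof -
  let ?A = "{N. N \<lhd> G \<and> S \<subseteq> N}"
  have ne: "carrier G \<in> ?A"
    using assms by (auto intro!: normalI subgroup_self simp: r_coset_def l_coset_def)
      (metis (no_types, opaque_lifting) inv_closed inv_solve_left inv_solve_right m_closed
         subgroup_self)+
  have sub: "subgroup (normal_closure G S) G"
    unfolding normal_closure_def
    by (rule subgroups_Inter) (use ne in \<open>auto dest: normal_imp_subgroup\<close>)
  show ?thesis
  proof (rule normal_invI[OF sub])
    fix x h assume "x \<in> carrier G" "h \<in> normal_closure G S"
    then show "x \<otimes> h \<otimes> inv x \<in> normal_closure G S"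
      unfolding normal_closure_def by (auto intro: normal.inv_op_closed2)
  qed
qed

lemma normal_closure_superset: "S \<subseteq> normal_closure G S"
  by (auto simp: normal_closure_def)


section \<open>Free product of two groups\<close>

text \<open>Words in the disjoint union of the carriers, modulo the least congruence for concatenation
  that identifies products within a factor and deletes the identities.\<close>

definition fp_words ::
    "('a, 'm) monoid_scheme \<Rightarrow> ('b, 'n) monoid_scheme \<Rightarrow> ('a + 'b) list set" where
  "fp_words G H = lists (carrier G <+> carrier H)"

inductive_set fp_rel ::
    "('a, 'm) monoid_scheme \<Rightarrow> ('b, 'n) monoid_scheme \<Rightarrow> (('a + 'b) list \<times> ('a + 'b) list) set"
  for G and H where
    refl: "w \<in> fp_words G H \<Longrightarrow> (w, w) \<in> fp_rel G H"
  | sym: "(u, v) \<in> fp_rel G H \<Longrightarrow> (v, u) \<in> fp_rel G H"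
  | trans: "(u, v) \<in> fp_rel G H \<Longrightarrow> (v, w) \<in> fp_rel G H \<Longrightarrow> (u, w) \<in> fp_rel G H"
  | append: "(u, u') \<in> fp_rel G H \<Longrightarrow> (v, v') \<in> fp_rel G H \<Longrightarrow> (u @ v, u' @ v') \<in> fp_rel G H"
  | one_left: "([Inl \<one>\<^bsub>G\<^esub>], []) \<in> fp_rel G H"
  | one_right: "([Inr \<one>\<^bsub>H\<^esub>], []) \<in> fp_rel G H"
  | mult_left: "x \<in> carrier G \<Longrightarrow> y \<in> carrier G \<Longrightarrow>
      ([Inl x, Inl y], [Inl (x \<otimes>\<^bsub>G\<^esub> y)]) \<in> fp_rel G H"
  | mult_right: "x \<in> carrier H \<Longrightarrow> y \<in> carrier H \<Longrightarrow>
      ([Inr x, Inr y], [Inr (x \<otimes>\<^bsub>H\<^esub> y)]) \<in> fp_rel G H"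

definition free_product ::
    "('a, 'm) monoid_scheme \<Rightarrow> ('b, 'n) monoid_scheme \<Rightarrow> ('a + 'b) list set monoid" where
  "free_product G H =
    \<lparr>carrier = fp_words G H // fp_rel G H,
     monoid.mult = (\<lambda>A B. \<Union>u\<in>A. \<Union>v\<in>B. fp_rel G H `` {u @ v}),
     one = fp_rel G H `` {[]}\<rparr>"

definition fp_inl ::
    "('a, 'm) monoid_scheme \<Rightarrow> ('b, 'n) monoid_scheme \<Rightarrow> 'a \<Rightarrow> ('a + 'b) list set" where
  "fp_inl G H x = fp_rel G H `` {[Inl x]}"

definition fp_inr ::
    "('a, 'm) monoid_scheme \<Rightarrow> ('b, 'n) monoid_scheme \<Rightarrow> 'b \<Rightarrow> ('a + 'b) list set" where
  "fp_inr G H y = fp_rel G H `` {[Inr y]}"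

lemma fp_words_simps [simp]:
  "[] \<in> fp_words G H"
  "Inl x # w \<in> fp_words G H \<longleftrightarrow> x \<in> carrier G \<and> w \<in> fp_words G H"
  "Inr y # w \<in> fp_words G H \<longleftrightarrow> y \<in> carrier H \<and> w \<in> fp_words G H"
  "u @ v \<in> fp_words G H \<longleftrightarrow> u \<in> fp_words G H \<and> v \<in> fp_words G H"
  by (auto simp: fp_words_def)

context
  fixes G :: "('a, 'm) monoid_scheme" and H :: "('b, 'n) monoid_scheme"
  assumes G: "group G" and H: "group H"
begin

lemma fp_rel_words: "(u, v) \<in> fp_rel G H \<Longrightarrow> u \<in> fp_words G H \<and> v \<in> fp_words G H"
  by (induction rule: fp_rel.induct)
    (auto simp: monoid.m_closed group.is_monoid G H monoid.one_closed)

lemma fp_rel_equiv: "equiv (fp_words G H) (fp_rel G H)"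
  by (rule equivI)
    (auto intro!: refl_onI symI transI intro: fp_rel.refl fp_rel.sym fp_rel.trans
      dest: fp_rel_words)

lemma fp_class_eq_iff:
  "u \<in> fp_words G H \<Longrightarrow> v \<in> fp_words G H \<Longrightarrow>
     fp_rel G H `` {u} = fp_rel G H `` {v} \<longleftrightarrow> (u, v) \<in> fp_rel G H"
  by (rule eq_equiv_class_iff[OF fp_rel_equiv])

lemma fp_mult_class:
  assumes "u \<in> fp_words G H" "v \<in> fp_words G H"
  shows "fp_rel G H `` {u} \<otimes>\<^bsub>free_product G H\<^esub> fp_rel G H `` {v} = fp_rel G H `` {u @ v}"
proof -
  have "congruent2 (fp_rel G H) (fp_rel G H) (\<lambda>u v. fp_rel G H `` {u @ v})"
    by (rule congruent2I')
      (auto intro!: equiv_class_eq[OF fp_rel_equiv] intro: fp_rel.append)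
  from UN_equiv_class2[OF fp_rel_equiv fp_rel_equiv this assms]
  show ?thesis by (simp add: free_product_def)
qed

lemma fp_class_carrier:
  "u \<in> fp_words G H \<Longrightarrow> fp_rel G H `` {u} \<in> carrier (free_product G H)"
  by (simp add: free_product_def quotientI)

lemma fp_carrierE:
  assumes "A \<in> carrier (free_product G H)"
  obtains u where "u \<in> fp_words G H" "A = fp_rel G H `` {u}"
  using assms by (auto simp: free_product_def elim: quotientE)

lemma fp_inverse_word:
  "u \<in> fp_words G H \<Longrightarrow> \<exists>v \<in> fp_words G H. (v @ u, []) \<in> fp_rel G H"
proof (induction u)
  case Nil
  then show ?case by (auto intro!: bexI[of _ "[]"] fp_rel.refl)
next
  case (Cons a u)
  obtain b where b: "[b] \<in> fp_words G H" "([b, a], []) \<in> fp_rel G H"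
  proof (cases a)
    case (Inl x)
    then have "x \<in> carrier G" using Cons.prems by simp
    then have "([Inl (inv\<^bsub>G\<^esub> x), Inl x], [Inl \<one>\<^bsub>G\<^esub>]) \<in> fp_rel G H"
      using fp_rel.mult_left[of "inv\<^bsub>G\<^esub> x" G x H] G by (simp add: group.l_inv)
    with that[of "Inl (inv\<^bsub>G\<^esub> x)"] show ?thesis
      using Inl \<open>x \<in> carrier G\<close> G by (auto intro: fp_rel.trans fp_rel.one_left)
  next
    case (Inr x)
    then have "x \<in> carrier H" using Cons.prems by simp
    then have "([Inr (inv\<^bsub>H\<^esub> x), Inr x], [Inr \<one>\<^bsub>H\<^esub>]) \<in> fp_rel G H"
      using fp_rel.mult_right[of "inv\<^bsub>H\<^esub> x" H x G] H by (simp add: group.l_inv)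
    with that[of "Inr (inv\<^bsub>H\<^esub> x)"] show ?thesis
      using Inr \<open>x \<in> carrier H\<close> H by (auto intro: fp_rel.trans fp_rel.one_right)
  qed
  have u: "u \<in> fp_words G H" using Cons.prems by (cases a) auto
  with Cons.IH obtain v where v: "v \<in> fp_words G H" "(v @ u, []) \<in> fp_rel G H" by blast
  have "(v @ ([b, a] @ u), v @ ([] @ u)) \<in> fp_rel G H"
    by (intro fp_rel.append fp_rel.refl b u v)
  then have "((v @ [b]) @ (a # u), []) \<in> fp_rel G H"
    using v(2) by (auto intro: fp_rel.trans)
  then show ?case using v b by (intro bexI[of _ "v @ [b]"]) auto
qed

lemma free_product_group: "group (free_product G H)"
proof (rule groupI)
  have one: "\<one>\<^bsub>free_product G H\<^esub> = fp_rel G H `` {[]}"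
    by (simp add: free_product_def)
  show "\<one>\<^bsub>free_product G H\<^esub> \<in> carrier (free_product G H)"
    by (simp add: one fp_class_carrier)
  fix A assume "A \<in> carrier (free_product G H)"
  then obtain u where u: "u \<in> fp_words G H" "A = fp_rel G H `` {u}"
    by (rule fp_carrierE)
  show "\<one>\<^bsub>free_product G H\<^esub> \<otimes>\<^bsub>free_product G H\<^esub> A = A"
    using u by (simp add: one fp_mult_class)
  obtain v where v: "v \<in> fp_words G H" "(v @ u, []) \<in> fp_rel G H"
    using fp_inverse_word u by blast
  show "\<exists>B\<in>carrier (free_product G H). B \<otimes>\<^bsub>free_product G H\<^esub> A = \<one>\<^bsub>free_product G H\<^esub>"
    using u v by (intro bexI[of _ "fp_rel G H `` {v}"])
      (simp_all add: one fp_mult_class fp_class_carrier fp_class_eq_iff)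
  fix B assume "B \<in> carrier (free_product G H)"
  then obtain v where v: "v \<in> fp_words G H" "B = fp_rel G H `` {v}"
    by (rule fp_carrierE)
  show "A \<otimes>\<^bsub>free_product G H\<^esub> B \<in> carrier (free_product G H)"
    using u v by (simp add: fp_mult_class fp_class_carrier)
  fix C assume "C \<in> carrier (free_product G H)"
  then obtain w where w: "w \<in> fp_words G H" "C = fp_rel G H `` {w}"
    by (rule fp_carrierE)
  show "A \<otimes>\<^bsub>free_product G H\<^esub> B \<otimes>\<^bsub>free_product G H\<^esub> C =
      A \<otimes>\<^bsub>free_product G H\<^esub> (B \<otimes>\<^bsub>free_product G H\<^esub> C)"
    using u v w by (simp add: fp_mult_class)
qed

lemma fp_inl_hom: "fp_inl G H \<in> hom G (free_product G H)"
  by (rule homI)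
    (auto simp: fp_inl_def fp_class_carrier fp_mult_class fp_class_eq_iff G
      monoid.m_closed group.is_monoid intro: fp_rel.sym fp_rel.mult_left)

lemma fp_inr_hom: "fp_inr G H \<in> hom H (free_product G H)"
  by (rule homI)
    (auto simp: fp_inr_def fp_class_carrier fp_mult_class fp_class_eq_iff H
      monoid.m_closed group.is_monoid intro: fp_rel.sym fp_rel.mult_right)

lemma free_product_lift:
  assumes K: "group K" and f: "f \<in> hom G K" and g: "g \<in> hom H K"
  shows "\<exists>h \<in> hom (free_product G H) K.
    (\<forall>x\<in>carrier G. h (fp_inl G H x) = f x) \<and> (\<forall>y\<in>carrier H. h (fp_inr G H y) = g y)"
proof -
  interpret K: group K by fact
  define ev where "ev w = foldr (\<lambda>a z. case_sum f g a \<otimes>\<^bsub>K\<^esub> z) w \<one>\<^bsub>K\<^esub>" for w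
  have ev_simps: "ev [] = \<one>\<^bsub>K\<^esub>" "ev (Inl x # w) = f x \<otimes>\<^bsub>K\<^esub> ev w"
    "ev (Inr y # w) = g y \<otimes>\<^bsub>K\<^esub> ev w" for x y w
    by (simp_all add: ev_def)
  have fc: "f x \<in> carrier K" if "x \<in> carrier G" for x using f that by (rule hom_in_carrier)
  have gc: "g x \<in> carrier K" if "x \<in> carrier H" for x using g that by (rule hom_in_carrier)
  have ev_closed: "ev w \<in> carrier K" if "w \<in> fp_words G H" for w
    using that
  proof (induction w)
    case (Cons a w) then show ?case by (cases a) (auto simp: ev_simps fc gc)
  qed (simp add: ev_simps)
  have ev_append: "ev (u @ v) = ev u \<otimes>\<^bsub>K\<^esub> ev v"
    if "u \<in> fp_words G H" "v \<in> fp_words G H" for u v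
    using that
  proof (induction u)
    case (Cons a w) then show ?case
      by (cases a) (auto simp: ev_simps fc gc ev_closed K.m_assoc)
  qed (simp add: ev_simps ev_closed)
  have ev_cong: "ev u = ev v" if "(u, v) \<in> fp_rel G H" for u v
    using that
  proof (induction rule: fp_rel.induct)
    case (append u u' v v')
    then show ?case by (simp add: ev_append fp_rel_words[of u u'] fp_rel_words[of v v'])
  next
    case one_left
    then show ?case by (simp add: ev_simps hom_one[OF f G K])
  next
    case one_right
    then show ?case by (simp add: ev_simps hom_one[OF g H K])
  next
    case (mult_left x y)
    then show ?case by (simp add: ev_simps hom_mult[OF f] fc)
  next
    case (mult_right x y)
    then show ?case by (simp add: ev_simps hom_mult[OF g] gc)
  qed simp_all
  define h where "h A = the_elem (ev ` A)" for A
  have h_class: "h (fp_rel G H `` {w}) = ev w" if "w \<in> fp_words G H" for w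
  proof -
    have "ev ` (fp_rel G H `` {w}) = {ev w}"
      using that by (auto simp: image_iff intro!: exI[of _ w] fp_rel.refl dest: ev_cong)
    then show ?thesis by (simp add: h_def)
  qed
  have "h \<in> hom (free_product G H) K"
    by (rule homI) (auto elim!: fp_carrierE simp: h_class ev_closed fp_mult_class ev_append)
  then show ?thesis
    by (intro bexI[of _ h]) (auto simp: fp_inl_def fp_inr_def h_class ev_simps fc gc)
qed

lemma free_product_generate:
  "carrier (free_product G H) =
     generate (free_product G H) (fp_inl G H ` carrier G \<union> fp_inr G H ` carrier H)"
proof -
  interpret F: group "free_product G H" by (rule free_product_group)
  let ?S = "fp_inl G H ` carrier G \<union> fp_inr G H ` carrier H"
  have S: "?S \<subseteq> carrier (free_product G H)"
    using fp_inl_hom fp_inr_hom by (auto simp: hom_in_carrier)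
  have "fp_rel G H `` {w} \<in> generate (free_product G H) ?S" if "w \<in> fp_words G H" for w
    using that
  proof (induction w)
    case Nil
    have "\<one>\<^bsub>free_product G H\<^esub> \<in> generate (free_product G H) ?S" by (rule generate.one)
    then show ?case by (simp add: free_product_def)
  next
    case (Cons a w)
    have w: "w \<in> fp_words G H" and a: "[a] \<in> fp_words G H"
      using Cons.prems by (cases a; simp)+
    have "fp_rel G H `` {[a]} \<in> ?S"
      using a by (cases a) (auto simp: fp_inl_def fp_inr_def)
    from generate.eng[OF generate.incl[OF this] Cons.IH[OF w]] show ?case
      by (simp add: fp_mult_class w a)
  qed
  then show ?thesis
    using F.generate_incl[OF S] by (auto elim!: fp_carrierE)
qed

end


section \<open>The weak commutativity group\<close>

text \<open>The copy \<open>G\<^sup>\<phi>\<close> is the second factor of the free product of \<open>G\<close> with itself: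
  \<open>g\<close> is the image of \<open>g\<close> under \<open>fp_inl\<close> and \<open>g\<^sup>\<phi>\<close> its image under \<open>fp_inr\<close>.\<close>

definition chi_relators :: "('a, 'm) monoid_scheme \<Rightarrow> ('a + 'a) list set set" where
  "chi_relators G =
    {commutator (free_product G G) (fp_inl G G g) (fp_inr G G g) | g. g \<in> carrier G}"

definition chi :: "('a, 'm) monoid_scheme \<Rightarrow> ('a + 'a) list set set monoid" where
  "chi G = free_product G G Mod normal_closure (free_product G G) (chi_relators G)"

definition chi_inl :: "('a, 'm) monoid_scheme \<Rightarrow> 'a \<Rightarrow> ('a + 'a) list set set" where
  "chi_inl G g =
    normal_closure (free_product G G) (chi_relators G) #>\<^bsub>free_product G G\<^esub> fp_inl G G g"

definition chi_inr :: "('a, 'm) monoid_scheme \<Rightarrow> 'a \<Rightarrow> ('a + 'a) list set set" where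
  "chi_inr G g =
    normal_closure (free_product G G) (chi_relators G) #>\<^bsub>free_product G G\<^esub> fp_inr G G g"

definition chi_D :: "('a, 'm) monoid_scheme \<Rightarrow> ('a + 'a) list set set set" where
  "chi_D G = commutator_subgroup (chi G) (chi_inl G ` carrier G) (chi_inr G ` carrier G)"

definition chi_D_group :: "('a, 'm) monoid_scheme \<Rightarrow> ('a + 'a) list set set monoid" where
  "chi_D_group G = (chi G)\<lparr>carrier := chi_D G\<rparr>"

context group
begin

lemma chi_relators_carrier: "chi_relators G \<subseteq> carrier (free_product G G)"
proof -
  interpret F: group "free_product G G" by (intro free_product_group group_axioms)
  show ?thesis
    using hom_in_carrier[OF fp_inl_hom[OF group_axioms group_axioms]]
      hom_in_carrier[OF fp_inr_hom[OF group_axioms group_axioms]]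
    by (auto simp: chi_relators_def commutator_def)
qed

lemma chi_kernel_normal:
  "normal_closure (free_product G G) (chi_relators G) \<lhd> free_product G G"
  by (intro group.normal_closure_normal free_product_group group_axioms chi_relators_carrier)

lemma chi_group: "group (chi G)"
  unfolding chi_def by (intro normal.factorgroup_is_group chi_kernel_normal)

lemma chi_inl_hom: "chi_inl G \<in> hom G (chi G)"
  using Group.hom_compose[OF fp_inl_hom[OF group_axioms group_axioms]
      normal.r_coset_hom_Mod[OF chi_kernel_normal]]
  by (simp add: chi_def chi_inl_def[abs_def] comp_def)

lemma chi_inr_hom: "chi_inr G \<in> hom G (chi G)"
  using Group.hom_compose[OF fp_inr_hom[OF group_axioms group_axioms]
      normal.r_coset_hom_Mod[OF chi_kernel_normal]]
  by (simp add: chi_def chi_inr_def[abs_def] comp_def)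

text \<open>Both copies of \<open>G\<close> embed: the homomorphism of the free product to \<open>G\<close> that is the identity
  on each factor kills the relators.\<close>

lemma chi_embeddings_inj:
  shows "inj_on (chi_inl G) (carrier G)" and "inj_on (chi_inr G) (carrier G)"
proof -
  let ?F = "free_product G G" and ?N = "normal_closure (free_product G G) (chi_relators G)"
  interpret F: group ?F by (intro free_product_group group_axioms)
  have idh: "(\<lambda>x. x) \<in> hom G G" by (auto intro: homI)
  obtain h where h: "h \<in> hom ?F G"
    and hl: "\<And>x. x \<in> carrier G \<Longrightarrow> h (fp_inl G G x) = x"
    and hr: "\<And>x. x \<in> carrier G \<Longrightarrow> h (fp_inr G G x) = x"
    using free_product_lift[OF group_axioms group_axioms group_axioms idh idh] by auto
  interpret h: group_hom ?F G h by unfold_locales (rule h)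
  note inc = hom_in_carrier[OF fp_inl_hom[OF group_axioms group_axioms]]
    hom_in_carrier[OF fp_inr_hom[OF group_axioms group_axioms]]
  have "h (commutator ?F (fp_inl G G x) (fp_inr G G x)) = \<one>" if "x \<in> carrier G" for x
    using that by (simp add: commutator_def inc hl hr m_assoc)
  then have "chi_relators G \<subseteq> kernel ?F G h"
    using chi_relators_carrier by (auto simp: kernel_def chi_relators_def)
  then have "?N \<subseteq> kernel ?F G h"
    unfolding normal_closure_def using h.normal_kernel by blast
  then have hN: "h n = \<one>" if "n \<in> ?N" for n
    using that by (auto simp: kernel_def)
  have N: "subgroup ?N ?F" using chi_kernel_normal by (rule normal_imp_subgroup)
  have key: "h a = h b"
    if "?N #>\<^bsub>?F\<^esub> a = ?N #>\<^bsub>?F\<^esub> b" "a \<in> carrier ?F" "b \<in> carrier ?F" for a b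
  proof -
    have "a \<in> ?N #>\<^bsub>?F\<^esub> b"
      using F.rcos_self[OF that(2) N] that(1) by simp
    then obtain n where "n \<in> ?N" "a = n \<otimes>\<^bsub>?F\<^esub> b" by (auto simp: r_coset_def)
    then show ?thesis
      using that subgroup.mem_carrier[OF N] by (simp add: hN)
  qed
  show "inj_on (chi_inl G) (carrier G)"
  proof (rule inj_onI)
    fix x y assume "x \<in> carrier G" "y \<in> carrier G" "chi_inl G x = chi_inl G y"
    then show "x = y"
      using key[of "fp_inl G G x" "fp_inl G G y"] by (simp add: chi_inl_def inc hl)
  qed
  show "inj_on (chi_inr G) (carrier G)"
  proof (rule inj_onI)
    fix x y assume "x \<in> carrier G" "y \<in> carrier G" "chi_inr G x = chi_inr G y"
    then show "x = y"
      using key[of "fp_inr G G x" "fp_inr G G y"] by (simp add: chi_inr_def inc hr)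
  qed
qed

lemma chi_D_subgroup: "subgroup (chi_D G) (chi G)"
proof -
  interpret X: group "chi G" by (rule chi_group)
  show ?thesis
    unfolding chi_D_def commutator_subgroup_def
    by (rule X.generate_is_subgroup)
      (auto simp: commutator_def hom_in_carrier[OF chi_inl_hom] hom_in_carrier[OF chi_inr_hom])
qed

lemma chi_D_group_group: "group (chi_D_group G)"
  unfolding chi_D_group_def by (intro group.subgroup_imp_group chi_group chi_D_subgroup)

end

end

theory Submission
  imports Defs
begin

text \<open>
  Conjugation by \<open>z\<close> and by \<open>z\<^sup>\<phi>\<close> agree on \<open>D = D(G)\<close>, so an element of \<open>\<chi>(G)\<close> acts on \<open>D\<close> through its
  image in \<open>G\<close> under the folding map. The image of \<open>D\<close> is the derived group, whence \<open>D\<close> has class at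
  most \<open>c = p - 1\<close>.

  For fixed \<open>g\<close>, let \<open>N\<close> be the group generated by the conjugates of \<open>g\<close> under \<open>G\<^sup>\<phi>\<close>, and
  \<open>M\<^sub>t = [N, \<gamma>\<^sub>t(G)\<^sup>\<phi>]\<close>. For \<open>m\<close> in \<open>\<gamma>\<^sub>t(G)\<close>, the element \<open>[g, m\<^sup>\<phi>]\<close> acts on \<open>D\<close> as \<open>[g, m]\<^sup>\<phi>\<close>, which lies
  in \<open>\<gamma>\<^sub>t\<^sub>+\<^sub>1(G)\<^sup>\<phi>\<close>; this yields \<open>[M\<^sub>t, N] \<subseteq> M\<^sub>t\<^sub>+\<^sub>1\<close> and \<open>[N, N] \<subseteq> M\<^sub>2\<close>, so \<open>N\<close> has class at most
  \<open>c\<close> as well. It contains \<open>[g, h\<^sup>\<phi>]\<close>.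

  In a group of class less than \<open>p\<close>, the elements of order dividing \<open>n = p\<^sup>e\<close> form a subgroup. Applied
  to \<open>N\<close> this gives \<open>[g, h\<^sup>\<phi>]\<^sup>n = 1\<close> for \<open>n = exp(G)\<close>, and applied to \<open>D\<close> it gives \<open>exp(D) | n\<close>. Modulo \<open>D\<close>
  the two copies of \<open>G\<close> commute, so \<open>x\<^sup>n\<close> lies in \<open>D\<close> for all \<open>x\<close>.

  The regularity statement rests on the Lazard-Leibman argument: sequences \<open>f\<close> whose \<open>r\<close>-th differences
  lie in \<open>\<gamma>\<^sub>r\<close> form a group, so \<open>y\<^sup>-\<^sup>m x\<^sup>-\<^sup>m (x y)\<^sup>m\<close> is a product of terms \<open>c\<^sub>s\<close> to the power \<open>m choose s\<close>
  with \<open>2 \<le> s < p\<close> and \<open>c\<^sub>s\<close> in \<open>\<gamma>\<^sub>s\<close>, and \<open>p\<^sup>e\<close> divides \<open>p\<^sup>e choose s\<close>.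
\<close>


section \<open>Commutator calculus\<close>

context group
begin

lemma inv_mult_cancel: "x \<in> carrier G \<Longrightarrow> y \<in> carrier G \<Longrightarrow> inv x \<otimes> (x \<otimes> y) = y"
  by (simp add: m_assoc[symmetric])

lemma mult_inv_cancel: "x \<in> carrier G \<Longrightarrow> y \<in> carrier G \<Longrightarrow> x \<otimes> (inv x \<otimes> y) = y"
  by (simp add: m_assoc[symmetric])

lemmas word_simps = m_assoc inv_mult_group inv_mult_cancel mult_inv_cancel

definition conj_by :: "'a \<Rightarrow> 'a \<Rightarrow> 'a" where
  "conj_by x g = inv g \<otimes> x \<otimes> g"

lemma conj_by_closed [simp, intro]:
  "x \<in> carrier G \<Longrightarrow> g \<in> carrier G \<Longrightarrow> conj_by x g \<in> carrier G"
  by (simp add: conj_by_def)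

lemma commutator_closed [simp, intro]:
  "x \<in> carrier G \<Longrightarrow> y \<in> carrier G \<Longrightarrow> commutator G x y \<in> carrier G"
  by (simp add: commutator_def)

lemma commutator_conj_by:
  "x \<in> carrier G \<Longrightarrow> y \<in> carrier G \<Longrightarrow> commutator G x y = inv x \<otimes> conj_by x y"
  by (simp add: commutator_def conj_by_def m_assoc)

lemma conj_by_commutator:
  "x \<in> carrier G \<Longrightarrow> y \<in> carrier G \<Longrightarrow> conj_by x y = x \<otimes> commutator G x y"
  by (simp add: commutator_def conj_by_def word_simps)

lemma conj_by_mult:
  "x \<in> carrier G \<Longrightarrow> y \<in> carrier G \<Longrightarrow> g \<in> carrier G \<Longrightarrow>
    conj_by (x \<otimes> y) g = conj_by x g \<otimes> conj_by y g"
  by (simp add: conj_by_def word_simps)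

lemma conj_by_inv:
  "x \<in> carrier G \<Longrightarrow> g \<in> carrier G \<Longrightarrow> conj_by (inv x) g = inv (conj_by x g)"
  by (simp add: conj_by_def word_simps)

lemma conj_by_one [simp]: "g \<in> carrier G \<Longrightarrow> conj_by \<one> g = \<one>" "g \<in> carrier G \<Longrightarrow> conj_by g \<one> = g"
  by (simp_all add: conj_by_def)

lemma conj_by_conj_by:
  "x \<in> carrier G \<Longrightarrow> g \<in> carrier G \<Longrightarrow> h \<in> carrier G \<Longrightarrow>
    conj_by (conj_by x g) h = conj_by x (g \<otimes> h)"
  by (simp add: conj_by_def word_simps)

lemma conj_by_pow:
  assumes "x \<in> carrier G" "g \<in> carrier G"
  shows "conj_by x g [^] (n::nat) = conj_by (x [^] n) g"
  by (induction n) (simp_all add: assms conj_by_mult)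

lemma conj_by_commutator_distrib:
  "x \<in> carrier G \<Longrightarrow> y \<in> carrier G \<Longrightarrow> g \<in> carrier G \<Longrightarrow>
    conj_by (commutator G x y) g = commutator G (conj_by x g) (conj_by y g)"
  by (simp add: conj_by_def commutator_def word_simps)

lemma commutator_mult_left:
  "x \<in> carrier G \<Longrightarrow> y \<in> carrier G \<Longrightarrow> z \<in> carrier G \<Longrightarrow>
    commutator G (x \<otimes> y) z = conj_by (commutator G x z) y \<otimes> commutator G y z"
  by (simp add: conj_by_def commutator_def word_simps)

lemma commutator_mult_right:
  "x \<in> carrier G \<Longrightarrow> y \<in> carrier G \<Longrightarrow> z \<in> carrier G \<Longrightarrow>
    commutator G x (y \<otimes> z) = commutator G x z \<otimes> conj_by (commutator G x y) z"
  by (simp add: conj_by_def commutator_def word_simps)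

lemma inv_commutator:
  "x \<in> carrier G \<Longrightarrow> y \<in> carrier G \<Longrightarrow> inv (commutator G x y) = commutator G y x"
  by (simp add: commutator_def word_simps)

lemma commutator_inv_left:
  "x \<in> carrier G \<Longrightarrow> z \<in> carrier G \<Longrightarrow>
    commutator G (inv x) z = conj_by (inv (commutator G x z)) (inv x)"
  by (simp add: conj_by_def commutator_def word_simps)

lemma commutator_one [simp]:
  "x \<in> carrier G \<Longrightarrow> commutator G x \<one> = \<one>" "x \<in> carrier G \<Longrightarrow> commutator G \<one> x = \<one>"
  "x \<in> carrier G \<Longrightarrow> commutator G x x = \<one>"
  by (simp_all add: commutator_def word_simps)

lemma commutator_eq_one:
  "x \<in> carrier G \<Longrightarrow> y \<in> carrier G \<Longrightarrow> conj_by x y = x \<Longrightarrow> commutator G x y = \<one>"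
  by (simp add: commutator_conj_by)

lemma Hall_Witt:
  assumes "x \<in> carrier G" "y \<in> carrier G" "z \<in> carrier G"
  shows "conj_by (commutator G (commutator G x (inv y)) z) y \<otimes>
    (conj_by (commutator G (commutator G y (inv z)) x) z \<otimes>
     conj_by (commutator G (commutator G z (inv x)) y) x) = \<one>"
  using assms by (simp add: conj_by_def commutator_def word_simps)

text \<open>Applied to the Hall-Witt identity this is the three subgroups argument: two factors in
  \<open>N\<close> force the third into \<open>N\<close>.\<close>

lemma mid_factor_mem:
  assumes "subgroup N G" "a \<in> N" "c \<in> N" "b \<in> carrier G" "a \<otimes> (b \<otimes> c) = \<one>"
  shows "b \<in> N"
proof -
  interpret N: subgroup N G by fact
  have "b = inv a \<otimes> (a \<otimes> (b \<otimes> c)) \<otimes> inv c" using assms(2-4) by (simp add: word_simps)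
  with assms show ?thesis by simp
qed

section \<open>Normal subgroups and commutators of generated subgroups\<close>

lemma normal_conj_by: "N \<lhd> G \<Longrightarrow> x \<in> N \<Longrightarrow> g \<in> carrier G \<Longrightarrow> conj_by x g \<in> N"
  by (simp add: conj_by_def normal.inv_op_closed1)

lemma normalI_conj_by:
  assumes "subgroup N G" "\<And>x g. x \<in> N \<Longrightarrow> g \<in> carrier G \<Longrightarrow> conj_by x g \<in> N"
  shows "N \<lhd> G"
  using assms(1)
proof (rule normal_invI)
  fix g x assume "g \<in> carrier G" "x \<in> N"
  with assms(2)[of x "inv g"] show "g \<otimes> x \<otimes> inv g \<in> N" by (simp add: conj_by_def)
qed

lemma normal_commutator_left:
  "N \<lhd> G \<Longrightarrow> x \<in> N \<Longrightarrow> g \<in> carrier G \<Longrightarrow> commutator G x g \<in> N"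
  using normal_conj_by[of N x g] normal_imp_subgroup[of N G]
  by (auto simp: commutator_conj_by subgroup.mem_carrier
      intro!: subgroup.m_closed subgroup.m_inv_closed)

lemma commutator_swap_mem:
  assumes "subgroup N G" "x \<in> carrier G" "y \<in> carrier G" "commutator G x y \<in> N"
  shows "commutator G y x \<in> N"
  using subgroup.m_inv_closed[OF assms(1,4)] assms(2,3) by (simp add: inv_commutator)

text \<open>Closure follows from \<open>[x y, t] = [x, t]^y [y, t]\<close>, where \<open>y\<close>
  in \<open>H\<close> keeps \<open>[x, t]^y\<close> inside \<open>N\<close>. The torsion argument
  uses this with \<open>H = F 1\<close>.\<close>

lemma subgroup_commute_mod:
  assumes N: "subgroup N G" and H: "subgroup H G" and T: "T \<subseteq> carrier G"
    and NH: "\<And>x h. x \<in> N \<Longrightarrow> h \<in> H \<Longrightarrow> conj_by x h \<in> N"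
  shows "subgroup {x \<in> H. \<forall>t\<in>T. commutator G x t \<in> N} G"
proof -
  interpret N: subgroup N G by fact
  interpret H: subgroup H G by fact
  have T: "t \<in> carrier G" if "t \<in> T" for t using T that by blast
  show ?thesis
  proof (rule subgroupI)
    show "{x \<in> H. \<forall>t\<in>T. commutator G x t \<in> N} \<noteq> {}" using T by (auto intro!: exI[of _ \<one>])
  qed (auto simp: commutator_mult_left commutator_inv_left T intro!: NH)
qed

text \<open>Two passes: the left entry is extended from \<open>S\<close> to its span against
  \<open>T\<close>, then the entries are swapped and \<open>T\<close> is extended with
  \<open>x\<close> fixed.\<close>

lemma commutator_generate:
  assumes N: "subgroup N G" and H: "subgroup H G" and S: "S \<subseteq> H" and T: "T \<subseteq> H"
    and NH: "\<And>x h. x \<in> N \<Longrightarrow> h \<in> H \<Longrightarrow> conj_by x h \<in> N"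
    and *: "\<And>s t. s \<in> S \<Longrightarrow> t \<in> T \<Longrightarrow> commutator G s t \<in> N"
    and x: "x \<in> generate G S" and y: "y \<in> generate G T"
  shows "commutator G x y \<in> N"
proof -
  interpret H: subgroup H G by fact
  have Sc: "S \<subseteq> carrier G" and Tc: "T \<subseteq> carrier G" using S T H.subset by auto
  have xc: "x \<in> carrier G" and yc: "y \<in> carrier G"
    using generate_in_carrier Sc Tc x y by blast+
  have "generate G S \<subseteq> {x \<in> H. \<forall>t\<in>T. commutator G x t \<in> N}"
    using S * by (intro generate_subgroup_incl subgroup_commute_mod N H Tc NH) auto
  with x have "commutator G t x \<in> N" if "t \<in> T" for t
    using that Tc xc by (intro commutator_swap_mem[OF N, of x t]) auto
  then have "generate G T \<subseteq> {y \<in> H. \<forall>t\<in>{x}. commutator G y t \<in> N}"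
    using T xc by (intro generate_subgroup_incl subgroup_commute_mod N H NH) auto
  with y show ?thesis by (intro commutator_swap_mem[OF N yc xc]) auto
qed

lemma commutator_generate_normal:
  assumes "N \<lhd> G" and S: "S \<subseteq> carrier G" and T: "T \<subseteq> carrier G"
    and *: "\<And>s t. s \<in> S \<Longrightarrow> t \<in> T \<Longrightarrow> commutator G s t \<in> N"
    and x: "x \<in> generate G S" and y: "y \<in> generate G T"
  shows "commutator G x y \<in> N"
  by (rule commutator_generate[OF normal_imp_subgroup[OF assms(1)] subgroup_self S T _ _ x y])
    (use assms(1) in \<open>auto intro: normal_conj_by *\<close>)

lemma commutator_subgroup_mem:
  "x \<in> H \<Longrightarrow> y \<in> K \<Longrightarrow> commutator G x y \<in> commutator_subgroup G H K"
  unfolding commutator_subgroup_def by (blast intro: generate.incl)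

lemma commutator_subgroup_is_subgroup:
  "H \<subseteq> carrier G \<Longrightarrow> K \<subseteq> carrier G \<Longrightarrow> subgroup (commutator_subgroup G H K) G"
  unfolding commutator_subgroup_def by (rule generate_is_subgroup) auto

lemma commutator_subgroup_least:
  assumes "subgroup N G" "\<And>x y. x \<in> H \<Longrightarrow> y \<in> K \<Longrightarrow> commutator G x y \<in> N"
  shows "commutator_subgroup G H K \<subseteq> N"
  unfolding commutator_subgroup_def using assms by (intro generate_subgroup_incl) auto

lemma generate_conj_by_closed:
  assumes S: "S \<subseteq> carrier G" and g: "g \<in> carrier G"
    and *: "\<And>s. s \<in> S \<Longrightarrow> conj_by s g \<in> generate G S" and x: "x \<in> generate G S"
  shows "conj_by x g \<in> generate G S"
proof -
  interpret H: subgroup "generate G S" G by (rule generate_is_subgroup[OF S])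
  have "subgroup {x \<in> carrier G. conj_by x g \<in> generate G S} G"
    using g by (intro subgroupI) (auto simp: conj_by_mult conj_by_inv)
  then have "generate G S \<subseteq> {x \<in> carrier G. conj_by x g \<in> generate G S}"
    using S * by (intro generate_subgroup_incl) auto
  with x show ?thesis by auto
qed

section \<open>The lower central series\<close>

lemma lower_central_normal: "lower_central G i \<lhd> G"
proof (induction i)
  case 0
  show ?case by (rule normalI_conj_by) (auto intro: subgroup_self)
next
  case (Suc i)
  let ?C = "{commutator G h k | h k. h \<in> lower_central G i \<and> k \<in> carrier G}"
  have sub: "lower_central G i \<subseteq> carrier G"
    using Suc by (meson normal_imp_subgroup subgroup.subset)
  then have C: "?C \<subseteq> carrier G" by auto
  have "conj_by x g \<in> generate G ?C" if "x \<in> generate G ?C" and g: "g \<in> carrier G" for x g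
  proof (rule generate_conj_by_closed[OF C g _ that(1)])
    fix s assume "s \<in> ?C"
    then obtain h k where hk: "s = commutator G h k" "h \<in> lower_central G i" "k \<in> carrier G"
      by blast
    then have "conj_by s g = commutator G (conj_by h g) (conj_by k g)"
      using sub g by (auto simp: conj_by_commutator_distrib)
    moreover have "conj_by h g \<in> lower_central G i" using normal_conj_by Suc hk g by blast
    ultimately show "conj_by s g \<in> generate G ?C" using hk g by (blast intro: generate.incl)
  qed
  with generate_is_subgroup[OF C] have "generate G ?C \<lhd> G"
    by (rule normalI_conj_by)
  then show ?case by (simp add: commutator_subgroup_def)
qed

lemma lower_central_subgroup: "subgroup (lower_central G i) G"
  by (rule normal_imp_subgroup[OF lower_central_normal])

lemma lower_central_carrier: "x \<in> lower_central G i \<Longrightarrow> x \<in> carrier G"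
  using subgroup.mem_carrier[OF lower_central_subgroup] .

lemma lower_central_Suc_subset: "lower_central G (Suc i) \<subseteq> lower_central G i"
  unfolding lower_central.simps
  by (rule commutator_subgroup_least[OF lower_central_subgroup])
    (rule normal_commutator_left[OF lower_central_normal])

lemma lower_central_antimono: "i \<le> j \<Longrightarrow> lower_central G j \<subseteq> lower_central G i"
  by (induction j rule: dec_induct) (use lower_central_Suc_subset in blast)+

lemma commutator_lower_central_carrier:
  "x \<in> lower_central G i \<Longrightarrow> y \<in> carrier G \<Longrightarrow> commutator G x y \<in> lower_central G (Suc i)"
  by (simp add: commutator_subgroup_mem)

lemma commutator_carrier_lower_central:
  "x \<in> carrier G \<Longrightarrow> y \<in> lower_central G i \<Longrightarrow> commutator G x y \<in> lower_central G (Suc i)"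
  by (rule commutator_swap_mem[OF lower_central_subgroup _ _ commutator_lower_central_carrier])
    (auto intro: lower_central_carrier)

text \<open>Three subgroups argument by induction on \<open>j\<close>: a generator of the next term
  is \<open>[v, g]\<close>, and Hall-Witt for \<open>x\<close>, \<open>v\<close>,
  \<open>inv g\<close> leaves \<open>[[v, g], x]\<close> between two known factors. The indexing
  from 0 accounts for the \<open>Suc\<close>.\<close>

lemma commutator_lower_central:
  "x \<in> lower_central G i \<Longrightarrow> y \<in> lower_central G j \<Longrightarrow>
    commutator G x y \<in> lower_central G (Suc (i + j))"
proof (induction j arbitrary: i x y)
  case 0
  then show ?case by (simp add: commutator_subgroup_mem)
next
  case (Suc j)
  let ?M = "lower_central G (Suc (i + Suc j))"
  note M = lower_central_normal[of "Suc (i + Suc j)"]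
  interpret M: subgroup ?M G by (rule lower_central_subgroup)
  let ?C = "{commutator G h k | h k. h \<in> lower_central G j \<and> k \<in> carrier G}"
  have C: "?C \<subseteq> carrier G" using lower_central_carrier by auto
  have x: "x \<in> carrier G" using Suc.prems lower_central_carrier by blast
  have *: "commutator G s t \<in> ?M" if "s \<in> ?C" "t \<in> {x}" for s t
  proof -
    from that obtain v g where vg: "s = commutator G v g" "v \<in> lower_central G j" "g \<in> carrier G"
      and t: "t = x" by blast
    have v: "v \<in> carrier G" using vg lower_central_carrier by blast
    \<comment> \<open>The first factor takes the induction hypothesis and then one more commutator.
      In the last one, \<open>[inv g, inv x]\<close> lies in term \<open>Suc i\<close>, so the
      induction hypothesis is used with \<open>Suc i\<close> for \<open>i\<close>.\<close>
    have "inv v \<in> lower_central G j" "inv x \<in> lower_central G i"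
      using vg Suc.prems subgroup.m_inv_closed[OF lower_central_subgroup] by blast+
    then have 1: "commutator G (commutator G x (inv v)) (inv g) \<in> ?M"
      and 2: "commutator G (commutator G (inv g) (inv x)) v \<in> ?M"
      using Suc.prems(1) vg Suc.IH[of x i "inv v"] Suc.IH[of "commutator G (inv g) (inv x)" "Suc i" v]
        commutator_carrier_lower_central[of "inv g" "inv x" i]
        commutator_lower_central_carrier[of "commutator G x (inv v)" "Suc (i + j)" "inv g"]
      by (auto simp del: lower_central.simps)
    let ?a = "conj_by (commutator G (commutator G x (inv v)) (inv g)) v"
    let ?b = "conj_by (commutator G (commutator G v g) x) (inv g)"
    let ?c = "conj_by (commutator G (commutator G (inv g) (inv x)) v) x"
    have cl: "?a \<in> carrier G" "?b \<in> carrier G" "?c \<in> carrier G" using v x vg by auto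
    have "?a \<otimes> (?b \<otimes> ?c) = \<one>" using Hall_Witt[OF x v, of "inv g"] vg by simp
    moreover have "?a \<in> ?M" "?c \<in> ?M" using 1 2 v x normal_conj_by[OF M] by blast+
    ultimately have "?b \<in> ?M"
      using mid_factor_mem[OF M.subgroup_axioms _ _ cl(2), of ?a ?c] by blast
    then have "conj_by ?b g \<in> ?M" using normal_conj_by[OF M] vg by blast
    then show ?thesis using vg v x t by (simp add: conj_by_conj_by)
  qed
  have y: "y \<in> generate G ?C" 
    using Suc.prems(2) unfolding lower_central.simps commutator_subgroup_def .
  have "commutator G y x \<in> ?M"
  proof (rule commutator_generate_normal[OF M C _ _ y])
    show "commutator G s t \<in> ?M" if "s \<in> ?C" "t \<in> {x}" for s t by (rule *[OF that])
    show "x \<in> generate G {x}" by (simp add: generate.incl)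
  qed (use x in blast)
  moreover have "y \<in> carrier G" using Suc.prems(2) by (rule lower_central_carrier)
  ultimately show ?case using x by (intro commutator_swap_mem[OF M.subgroup_axioms, of y x])
qed

end


section \<open>Polynomial sequences\<close>

text \<open>If \<open>a\<close> and \<open>b\<close> are the differences of two sequences with
  current values \<open>f\<close> and \<open>g\<close>, the left side is the difference of their
  commutator. Each of the brackets \<open>[f, b]\<close>, \<open>[a, b]\<close>,
  \<open>[[f, g], a b]\<close> and \<open>[a, g]\<close> on the right has higher degree than
  \<open>[f, g]\<close>.\<close>

lemma (in group) commutator_mult_mult:
  assumes "f \<in> carrier G" "g \<in> carrier G" "a \<in> carrier G" "b \<in> carrier G"
  shows "inv (commutator G f g) \<otimes> commutator G (f \<otimes> a) (g \<otimes> b) =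
    conj_by (conj_by (commutator G f b) a \<otimes> commutator G a b) (commutator G f g) \<otimes>
      (commutator G (commutator G f g) (a \<otimes> b) \<otimes> conj_by (commutator G a g) b)"
proof -
  have "inv z \<otimes> (u \<otimes> (conj_by z c \<otimes> w)) = conj_by u z \<otimes> (commutator G z c \<otimes> w)"
    if "z \<in> carrier G" "u \<in> carrier G" "c \<in> carrier G" "w \<in> carrier G" for z u c w
    using that by (simp add: conj_by_def commutator_def word_simps)
  moreover have "commutator G (f \<otimes> a) (g \<otimes> b) =
      (conj_by (commutator G f b) a \<otimes> commutator G a b) \<otimes>
      (conj_by (commutator G f g) (a \<otimes> b) \<otimes> conj_by (commutator G a g) b)"
    using assms
    by (simp add: commutator_mult_left commutator_mult_right conj_by_mult conj_by_conj_by m_assoc)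
  ultimately show ?thesis using assms by simp
qed

text \<open>General filtrations, because the torsion induction changes the series twice.
  \<open>F 0\<close> may be smaller than the carrier, so all of them live in the same group.\<close>

locale N_series = group G for G (structure) +
  fixes F :: "nat \<Rightarrow> 'a set"
  assumes F_subgroup: "subgroup (F i) G"
    and F_Suc: "F (Suc i) \<subseteq> F i"
    and F_commutator: "x \<in> F i \<Longrightarrow> y \<in> F j \<Longrightarrow> commutator G x y \<in> F (i + j)"
begin

lemma F_antimono: "i \<le> j \<Longrightarrow> F j \<subseteq> F i"
  by (induction j rule: dec_induct) (use F_Suc in blast)+

lemma F_carrier: "x \<in> F i \<Longrightarrow> x \<in> carrier G"
  using subgroup.mem_carrier[OF F_subgroup] .

text \<open>Truncating at the \<open>r\<close>-th difference lets closure under products and under commutators be proved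
  by one induction on \<open>r\<close>; for sequences with all differences controlled, each would need the
  other.\<close>

primrec poly :: "nat \<Rightarrow> nat \<Rightarrow> (nat \<Rightarrow> 'a) \<Rightarrow> bool" where
  "poly 0 i f \<longleftrightarrow> (\<forall>m. f m \<in> F i)"
| "poly (Suc r) i f \<longleftrightarrow> poly r i f \<and> poly r (Suc i) (\<lambda>m. inv (f m) \<otimes> f (Suc m))"

lemma poly_mem: "poly r i f \<Longrightarrow> f m \<in> F i"
  by (induction r arbitrary: m) auto

lemma poly_carrier: "poly r i f \<Longrightarrow> f m \<in> carrier G"
  by (rule F_carrier[OF poly_mem])

lemma poly_Suc: "poly r (Suc i) f \<Longrightarrow> poly r i f"
  by (induction r arbitrary: i f) (use F_Suc in auto)

lemma poly_antimono: "i \<le> j \<Longrightarrow> poly r j f \<Longrightarrow> poly r i f"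
  by (induction j rule: dec_induct) (auto intro: poly_Suc)

text \<open>With differences \<open>a\<close> of \<open>f\<close> and \<open>b\<close> of
  \<open>g\<close>, the difference of \<open>f g\<close> is \<open>a^g b\<close>, that of
  \<open>inv f\<close> is a conjugate of \<open>inv a\<close>, and that of \<open>[f, g]\<close> is
  given by \<open>commutator_mult_mult\<close>. Conjugation is handled as
  \<open>x^y = x [x, y]\<close>.\<close>

lemma poly_group:
  "(poly r i f \<longrightarrow> poly r i g \<longrightarrow> poly r i (\<lambda>m. f m \<otimes> g m)) \<and>
   (poly r i f \<longrightarrow> poly r i (\<lambda>m. inv (f m))) \<and>
   (poly r i f \<longrightarrow> poly r j g \<longrightarrow> poly r (i + j) (\<lambda>m. commutator G (f m) (g m)))"
proof (induction r arbitrary: i j f g)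
  case 0
  show ?case
    using subgroup.m_closed[OF F_subgroup] subgroup.m_inv_closed[OF F_subgroup] F_commutator
    by simp
next
  case (Suc r)
  have mult: "poly r i (\<lambda>m. f m \<otimes> g m)" if "poly r i f" "poly r i g" for i f g
    using Suc.IH that by blast
  have inv: "poly r i (\<lambda>m. inv (f m))" if "poly r i f" for i f
    using Suc.IH that by blast
  have comm: "poly r (i + j) (\<lambda>m. commutator G (f m) (g m))" if "poly r i f" "poly r j g" for i j f g
    using Suc.IH that by blast
  have conj: "poly r i (\<lambda>m. conj_by (f m) (g m))" if "poly r i f" "poly r j g" for i j f g
  proof -
    have "poly r i (\<lambda>m. f m \<otimes> commutator G (f m) (g m))"
      using that comm by (intro mult) (auto intro: poly_antimono[of i "i + j"])
    then show ?thesis using that by (simp add: conj_by_commutator poly_carrier)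
  qed
  have shift: "f (Suc m) = f m \<otimes> (inv (f m) \<otimes> f (Suc m))" if "poly r i f" for i f m
    using that by (simp add: mult_inv_cancel poly_carrier)
  show ?case
  proof (intro conjI impI)
    assume f: "poly (Suc r) i f" and g: "poly (Suc r) i g"
    define a where "a m = inv (f m) \<otimes> f (Suc m)" for m
    define b where "b m = inv (g m) \<otimes> g (Suc m)" for m
    have fr: "poly r i f" and gr: "poly r i g" and a: "poly r (Suc i) a" and b: "poly r (Suc i) b"
      using f g by (simp_all add: a_def[abs_def] b_def[abs_def])
    have "poly r (Suc i) (\<lambda>m. conj_by (a m) (g m) \<otimes> b m)"
      by (intro mult conj[OF a gr] b)
    moreover have "conj_by (a m) (g m) \<otimes> b m = inv (f m \<otimes> g m) \<otimes> (f (Suc m) \<otimes> g (Suc m))" for m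
      using fr gr by (simp add: a_def b_def conj_by_def word_simps poly_carrier)
    ultimately show "poly (Suc r) i (\<lambda>m. f m \<otimes> g m)"
      using mult[OF fr gr] by simp
  next
    assume f: "poly (Suc r) i f"
    define a where "a m = inv (f m) \<otimes> f (Suc m)" for m
    have fr: "poly r i f" and a: "poly r (Suc i) a"
      using f by (simp_all add: a_def[abs_def])
    have "poly r (Suc i) (\<lambda>m. conj_by (inv (a m)) (inv (f m)))"
      by (intro conj[OF inv[OF a] inv[OF fr]])
    moreover have "conj_by (inv (a m)) (inv (f m)) = inv (inv (f m)) \<otimes> inv (f (Suc m))" for m
      using fr by (simp add: a_def conj_by_def word_simps poly_carrier)
    ultimately show "poly (Suc r) i (\<lambda>m. inv (f m))"
      using inv[OF fr] by simp
  next
    assume f: "poly (Suc r) i f" and g: "poly (Suc r) j g"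
    define a where "a m = inv (f m) \<otimes> f (Suc m)" for m
    define b where "b m = inv (g m) \<otimes> g (Suc m)" for m
    define z where "z m = commutator G (f m) (g m)" for m
    have fr: "poly r i f" and gr: "poly r j g" and a: "poly r (Suc i) a" and b: "poly r (Suc j) b"
      using f g by (simp_all add: a_def[abs_def] b_def[abs_def])
    have z: "poly r (i + j) z" unfolding z_def[abs_def] by (rule comm[OF fr gr])
    have fb: "poly r (Suc (i + j)) (\<lambda>m. commutator G (f m) (b m))"
      using comm[OF fr b] by simp
    have ag: "poly r (Suc (i + j)) (\<lambda>m. commutator G (a m) (g m))"
      using comm[OF a gr] by simp
    have ab: "poly r (Suc (i + j)) (\<lambda>m. commutator G (a m) (b m))"
      using comm[OF a b] by (auto intro: poly_antimono[of _ "Suc i + Suc j"])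
    have "poly r 1 (\<lambda>m. a m \<otimes> b m)"
      by (intro mult poly_antimono[OF _ a] poly_antimono[OF _ b]) simp_all
    from comm[OF z this] have zab: "poly r (Suc (i + j)) (\<lambda>m. commutator G (z m) (a m \<otimes> b m))"
      by simp
    have "poly r (Suc (i + j)) (\<lambda>m.
        conj_by (conj_by (commutator G (f m) (b m)) (a m) \<otimes> commutator G (a m) (b m)) (z m) \<otimes>
        (commutator G (z m) (a m \<otimes> b m) \<otimes> conj_by (commutator G (a m) (g m)) (b m)))"
      by (intro mult conj[OF _ z] conj[OF fb a] ab zab conj[OF ag b])
    moreover have
      "conj_by (conj_by (commutator G (f m) (b m)) (a m) \<otimes> commutator G (a m) (b m)) (z m) \<otimes>
        (commutator G (z m) (a m \<otimes> b m) \<otimes> conj_by (commutator G (a m) (g m)) (b m)) =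
       inv (z m) \<otimes> commutator G (f (Suc m)) (g (Suc m))" for m
    proof -
      have "f (Suc m) = f m \<otimes> a m" "g (Suc m) = g m \<otimes> b m"
        unfolding a_def b_def by (rule shift[OF fr], rule shift[OF gr])
      moreover have "f m \<in> carrier G" "g m \<in> carrier G" "a m \<in> carrier G" "b m \<in> carrier G"
        using fr gr a b by (auto intro: poly_carrier)
      ultimately show ?thesis
        by (simp add: z_def commutator_mult_mult)
    qed
    ultimately show "poly (Suc r) (i + j) (\<lambda>m. commutator G (f m) (g m))"
      using z by (simp add: z_def[abs_def])
  qed
qed

lemma poly_mult: "poly r i f \<Longrightarrow> poly r i g \<Longrightarrow> poly r i (\<lambda>m. f m \<otimes> g m)"
  and poly_inv: "poly r i f \<Longrightarrow> poly r i (\<lambda>m. inv (f m))"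
  using poly_group by blast+

text \<open>By Pascal's rule the difference of \<open>c^(m choose t)\<close> is
  \<open>c^(m choose (t - 1))\<close>, and it is trivial for \<open>t = 0\<close>. As
  \<open>t\<close> drops the degree \<open>i\<close> rises, so \<open>i + t\<close> does not
  grow.\<close>

lemma poly_binomial:
  "c \<in> F j \<Longrightarrow> i + t \<le> j \<Longrightarrow> poly r i (\<lambda>m. c [^] (m choose t))"
proof (induction r arbitrary: i t)
  case 0
  then have "c \<in> F i" using F_antimono[of i j] by auto
  then have "c [^] (n::nat) \<in> F i" for n
    using subgroup_is_submonoid[OF F_subgroup]
    by (induction n) (auto intro: subgroup.m_closed subgroup.one_closed F_subgroup)
  then show ?case by simp
next
  case (Suc r)
  have c: "c \<in> carrier G" using Suc.prems F_carrier by blast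
  have "poly r (Suc i) (\<lambda>m. inv (c [^] (m choose t)) \<otimes> c [^] (Suc m choose t))"
  proof (cases t)
    case 0
    have "poly r (Suc i) (\<lambda>m. \<one>)" for r
      by (induction r arbitrary: i) (auto intro: subgroup.one_closed F_subgroup)
    then show ?thesis using 0 c by simp
  next
    case (Suc s)
    have "inv (c [^] (m choose t)) \<otimes> c [^] (Suc m choose t) = c [^] (m choose s)" for m
    proof -
      have "c [^] (Suc m choose t) = c [^] (m choose t) \<otimes> c [^] (m choose s)"
        using c Suc by (simp add: nat_pow_mult add.commute)
      then show ?thesis using c by (simp add: inv_mult_cancel)
    qed
    then show ?thesis using Suc.IH[of "Suc i" s] Suc.prems Suc by simp
  qed
  then show ?case using Suc.IH Suc.prems by simp
qed

text \<open>As the earlier values are trivial, \<open>f r\<close> equals the \<open>r\<close>-th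
  difference of \<open>f\<close> at 0.\<close>

lemma poly_first_nontrivial:
  "poly r i f \<Longrightarrow> (\<And>m. m < r \<Longrightarrow> f m = \<one>) \<Longrightarrow> f r \<in> F (i + r)"
proof (induction r arbitrary: i f)
  case (Suc r)
  have "inv (f r) \<otimes> f (Suc r) \<in> F (Suc i + r)"
    using Suc.prems by (intro Suc.IH) auto
  then show ?case using Suc.prems poly_carrier[OF Suc.prems(1)] by simp
qed simp

text \<open>Induction on \<open>p - s\<close>, clearing one value at a time: dividing by
  \<open>c^(m choose s)\<close> with \<open>c = f s\<close> makes the value at \<open>s\<close>
  trivial and keeps the earlier ones. Once \<open>s\<close> reaches \<open>p\<close>, every further
  value lies in \<open>F p\<close>.\<close>

lemma poly_value_one:
  assumes p: "Factorial_Ring.prime p" and n: "n = p ^ e" and Fp: "F p = {\<one>}"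
    and exp: "\<And>x. x \<in> F 2 \<Longrightarrow> x [^] n = \<one>"
    and f: "\<And>r. poly r 0 f" and f01: "\<And>m. m < s \<Longrightarrow> f m = \<one>" and s: "2 \<le> s"
  shows "f n = \<one>"
  using f f01 s
proof (induction "p - s" arbitrary: f s)
  case 0
  have "f m = \<one>" for m
  proof (induction m rule: less_induct)
    case (less m)
    show ?case
    proof (cases "m < s")
      case False
      have "f m \<in> F (0 + m)" using less 0 by (intro poly_first_nontrivial) auto
      moreover have "F m \<subseteq> F p" using False 0 by (intro F_antimono) auto
      ultimately show ?thesis using Fp by auto
    qed (use 0 in auto)
  qed
  then show ?case .
next
  case (Suc d)
  define c where "c = f s"
  have c: "c \<in> F s"
    unfolding c_def using poly_first_nontrivial[of s 0 f] Suc.prems by simp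
  then have cG: "c \<in> carrier G" by (rule F_carrier)
  \<comment> \<open>Removing the term of index \<open>s\<close> does not change the value at \<open>n\<close>.\<close>
  define h where "h m = f m \<otimes> inv (c [^] (m choose s))" for m
  \<comment> \<open>Here \<open>2 \<le> s < p\<close>, so \<open>s\<close> is prime to
    \<open>n\<close> and cancels from
    \<open>s * (n choose s) = n * ((n - 1) choose (s - 1))\<close>.\<close>
  have "n dvd n choose s"
  proof -
    have "coprime n s"
      unfolding n using p Suc.prems Suc.hyps
      by (auto intro!: coprime_power_left_iff[THEN iffD2] prime_imp_coprime dest: dvd_imp_le)
    moreover have "s * (n choose s) = n * ((n - 1) choose (s - 1))"
      using Suc.prems by (intro times_binomial_minus1_eq) simp
    ultimately show ?thesis
      by (metis coprime_dvd_mult_right_iff dvd_triv_left)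
  qed
  then obtain k where "n choose s = n * k" by blast
  moreover have "c [^] n = \<one>"
    using c F_antimono[of 2 s] Suc.prems by (intro exp) auto
  ultimately have "c [^] (n choose s) = \<one>"
    using cG by (simp add: nat_pow_pow[symmetric])
  then have hn: "h n = f n"
    using poly_carrier[OF Suc.prems(1)] by (simp add: h_def)
  have "h n = \<one>"
  proof (rule Suc.hyps(1)[of "Suc s"])
    show "poly r 0 h" for r
      unfolding h_def[abs_def] using c Suc.prems(1)
      by (intro poly_mult poly_inv poly_binomial[of _ s]) auto
    show "h m = \<one>" if "m < Suc s" for m
      using that Suc.prems(2)[of m] cG
      by (cases "m = s") (auto simp: h_def c_def binomial_eq_0)
  qed (use Suc in auto)
  with hn show ?case by simp
qed

text \<open>The sequence \<open>y^-m x^-m (x y)^m\<close> starts with two trivial values, so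
  collection begins in degree 2. This is why \<open>F 2\<close> has to have exponent dividing
  \<open>n\<close>.\<close>

lemma mult_pow_eq_one:
  assumes p: "Factorial_Ring.prime p" and n: "n = p ^ e" and Fp: "F p = {\<one>}"
    and exp: "\<And>x. x \<in> F 2 \<Longrightarrow> x [^] n = \<one>"
    and F0: "F 0 = F 1" and x: "x \<in> F 1" "x [^] n = \<one>" and y: "y \<in> F 1" "y [^] n = \<one>"
  shows "(x \<otimes> y) [^] n = \<one>"
proof -
  define f where "f m = inv (y [^] m) \<otimes> (inv (x [^] m) \<otimes> (x \<otimes> y) [^] m)" for m :: nat
  have xy: "x \<in> carrier G" "y \<in> carrier G" using x y F_carrier by auto
  have pow: "poly r 0 (\<lambda>m. u [^] m)" if "u \<in> F 1" for u r
    using poly_binomial[OF that, of 0 1 r] by simp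
  have "f n = \<one>"
  proof (rule poly_value_one[OF p n Fp exp, of f 2])
    show "poly r 0 f" for r
      unfolding f_def[abs_def] using x y
      by (intro poly_mult poly_inv pow subgroup.m_closed[OF F_subgroup])
    show "f m = \<one>" if "m < 2" for m
    proof -
      have "m = 0 \<or> m = 1" using that by auto
      then show ?thesis using xy by (auto simp: f_def word_simps)
    qed
  qed auto
  then show ?thesis using x y xy by (simp add: f_def)
qed

end


section \<open>Torsion in groups of small class\<close>

text \<open>Induction on the class. \<open>mult_pow_eq_one\<close> wants every element of
  \<open>F 2\<close> to have order dividing \<open>n\<close>, so the series is replaced by one whose
  terms from degree 2 on consist of such elements; the induction hypothesis shows that these terms
  are subgroups.\<close>

lemma N_series_torsion_mult:
  fixes G (structure)
  assumes p: "Factorial_Ring.prime p" and n: "n = p ^ e"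
  shows "N_series G F \<Longrightarrow> F 0 = F 1 \<Longrightarrow> F (Suc k) = {\<one>} \<Longrightarrow> k < p \<Longrightarrow>
    x \<in> F 1 \<Longrightarrow> y \<in> F 1 \<Longrightarrow> x [^] n = \<one> \<Longrightarrow> y [^] n = \<one> \<Longrightarrow> (x \<otimes> y) [^] n = \<one>"
proof (induction k arbitrary: F x y)
  case 0
  interpret N_series G F by fact
  show ?case using 0 by auto
next
  case (Suc k)
  interpret N_series G F by fact
  have "F p \<subseteq> F (Suc (Suc k))" using Suc.prems by (intro F_antimono) simp
  then have Fp: "F p = {\<one>}"
    using Suc.prems subgroup.one_closed[OF F_subgroup] by auto
  show ?case
  proof (cases "k = 0")
    case True
    then have "F 2 = {\<one>}" using Suc.prems by (simp add: numeral_2_eq_2)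
    then show ?thesis using Suc.prems Fp by (intro mult_pow_eq_one[OF p n]) auto
  next
    case False
    define S where "S = {s \<in> F 1. s [^] n = \<one>}"
    have S_inv: "inv s \<in> S" if "s \<in> S" for s
      using that F_carrier by (auto simp: S_def nat_pow_inv subgroup.m_inv_closed[OF F_subgroup])
    have F_conj: "conj_by s t \<in> F i" if "s \<in> F i" "t \<in> F 1" for s t i
    proof -
      have "commutator G s t \<in> F i" using F_commutator[OF that] F_antimono[of i "i + 1"] by auto
      then show ?thesis
        using that by (simp add: conj_by_commutator F_carrier subgroup.m_closed[OF F_subgroup])
    qed
    have S_conj: "conj_by s t \<in> S" if "s \<in> S" "t \<in> F 1" for s t
      using that F_conj F_carrier by (auto simp: S_def conj_by_pow)
    \<comment> \<open>The group generated by \<open>s\<close> and \<open>F 2\<close> carries the shorter series \<open>F 3, F 4, \<dots>\<close>, so the induction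
      hypothesis applies; it contains \<open>[s, t]\<close> as a product of two torsion elements.\<close>
    have S_mult: "a \<otimes> b \<in> S"
      if s: "s \<in> S" and a: "a \<in> generate G (insert s (F 2))" and b: "b \<in> generate G (insert s (F 2))"
        and aS: "a \<in> S" and bS: "b \<in> S" for s a b
    proof -
      let ?M = "generate G (insert s (F 2))"
      let ?E = "\<lambda>i. if i \<le> 1 then ?M else F (Suc i)"
      have ins: "insert s (F 2) \<subseteq> F 1"
        using s F_antimono[of 1 2] by (auto simp: S_def)
      have insG: "insert s (F 2) \<subseteq> carrier G"
        using ins F_carrier by blast
      have M1: "?M \<subseteq> F 1" by (intro generate_subgroup_incl ins F_subgroup)
      interpret M: subgroup ?M G by (rule generate_is_subgroup[OF insG])
      have F2M: "F 2 \<subseteq> ?M" by (auto intro: generate.incl)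
      \<comment> \<open>Since \<open>[s, s] = \<one>\<close>, the commutators of generators already
        lie in \<open>F 3\<close>. The series \<open>?E\<close> can therefore skip
        \<open>F 2\<close> and ends one step earlier.\<close>
      have MM: "commutator G u v \<in> F 3" if "u \<in> ?M" "v \<in> ?M" for u v
      proof (rule commutator_generate[OF F_subgroup F_subgroup ins ins _ _ that])
        fix u v assume "u \<in> insert s (F 2)" "v \<in> insert s (F 2)"
        then show "commutator G u v \<in> F 3"
          using F_commutator[of u 1 v 2] F_commutator[of u 2 v 1] F_commutator[of u 2 v 2]
            F_antimono[of 3 4] subgroup.one_closed[OF F_subgroup] ins insG
          by (auto simp: eval_nat_numeral)
      qed (rule F_conj)
      have "N_series G ?E"
      proof (intro N_series.intro N_series_axioms.intro group_axioms)
        fix i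
        show "subgroup (?E i) G" by (simp add: F_subgroup M.subgroup_axioms)
        show "?E (Suc i) \<subseteq> ?E i"
          using F_Suc[of "Suc i"] F_antimono[of 2 "Suc (Suc i)"] F2M by auto
        fix x y j assume x: "x \<in> ?E i" and y: "y \<in> ?E j"
        show "commutator G x y \<in> ?E (i + j)"
        proof (cases "i \<le> 1 \<and> j \<le> 1")
          case True
          have "commutator G x y \<in> ?M" using x y True M.mem_carrier by (auto simp: commutator_def)
          moreover have "commutator G x y \<in> F 3" using x y True MM by auto
          moreover have "i + j \<le> 1 \<or> Suc (i + j) = 3" using True by auto
          ultimately show ?thesis by auto
        next
          case False
          \<comment> \<open>In degree at most 1 the elements of \<open>?E\<close> lie in
            \<open>F 1\<close>, otherwise one step deeper than their index. With one of the latter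
            present, the shift by one survives in the sum.\<close>
          define i' j' where "i' = (if i \<le> 1 then 1 else Suc i)" and "j' = (if j \<le> 1 then 1 else Suc j)"
          have "x \<in> F i'" "y \<in> F j'" using x y M1 by (auto simp: i'_def j'_def split: if_splits)
          then have "commutator G x y \<in> F (i' + j')" by (rule F_commutator)
          moreover have "Suc (i + j) \<le> i' + j'" using False by (auto simp: i'_def j'_def)
          ultimately show ?thesis using False F_antimono by auto
        qed
      qed
      then have "(a \<otimes> b) [^] n = \<one>"
        using Suc.IH[of ?E a b] Suc.prems False a b aS bS by (simp add: S_def)
      then show ?thesis using aS bS by (simp add: S_def subgroup.m_closed[OF F_subgroup])
    qed
    have F2: "F 2 \<subseteq> F 1" by (rule F_antimono) simp
    have T: "subgroup (F 2 \<inter> S) G"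
    proof (rule subgroupI)
      show "F 2 \<inter> S \<subseteq> carrier G" using F_carrier by auto
      have "\<one> \<in> F 2 \<inter> S" using subgroup.one_closed[OF F_subgroup] by (simp add: S_def)
      then show "F 2 \<inter> S \<noteq> {}" by blast
      fix a assume a: "a \<in> F 2 \<inter> S"
      then show "inv a \<in> F 2 \<inter> S" using S_inv subgroup.m_inv_closed[OF F_subgroup] by auto
      fix b assume b: "b \<in> F 2 \<inter> S"
      then show "a \<otimes> b \<in> F 2 \<inter> S"
        using a S_mult[of a a b] subgroup.m_closed[OF F_subgroup] by (auto intro: generate.incl)
    qed
    have S_comm: "commutator G s t \<in> F 2 \<inter> S" if "s \<in> S" "t \<in> F 1" for s t
    proof -
      have sG: "s \<in> carrier G" "t \<in> carrier G" using that F_carrier by (auto simp: S_def)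
      have c2: "commutator G s t \<in> F 2" using F_commutator[of s 1 t 1] that by (simp add: S_def numeral_2_eq_2)
      have s_gen: "s \<in> generate G (insert s (F 2))" by (auto intro: generate.incl)
      moreover have "commutator G s t \<in> generate G (insert s (F 2))" using c2 by (auto intro: generate.incl)
      ultimately have "conj_by s t \<in> generate G (insert s (F 2))"
        using sG by (simp add: conj_by_commutator generate.eng)
      moreover have "inv s \<in> generate G (insert s (F 2))" by (auto intro: generate.inv)
      ultimately have "inv s \<otimes> conj_by s t \<in> S"
        by (intro S_mult[OF that(1)] S_inv S_conj that)
      then show ?thesis using c2 sG by (simp add: commutator_conj_by)
    qed
    \<comment> \<open>Commutators of \<open>K\<close> fall into the torsion subgroup
      \<open>F 2 \<inter> S\<close>, which can thus follow \<open>K\<close> as the term of degree 2.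
      All torsion elements of \<open>F 1\<close> lie in \<open>K\<close>, in particular
      \<open>x\<close> and \<open>y\<close>.\<close>
    define K where "K = {x \<in> F 1. \<forall>t\<in>F 1. commutator G x t \<in> F 2 \<inter> S}"
    have "subgroup K G"
      unfolding K_def using F_carrier
      by (intro subgroup_commute_mod T F_subgroup) (auto intro: F_conj S_conj)
    then interpret K: subgroup K G .
    have SK: "S \<subseteq> K" using S_comm by (auto simp: K_def S_def)
    let ?E = "\<lambda>i. if i \<le> 1 then K else F i \<inter> S"
    have E: "N_series G ?E"
    proof (intro N_series.intro N_series_axioms.intro group_axioms)
      fix i
      show "subgroup (?E i) G"
      proof (cases "i \<le> 1")
        case False
        then have "F i \<inter> S = F i \<inter> (F 2 \<inter> S)" using F_antimono[of 2 i] by auto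
        with False show ?thesis using subgroups_Inter_pair[OF F_subgroup T, of i] by simp
      qed (use K.subgroup_axioms in simp)
      show "?E (Suc i) \<subseteq> ?E i" using F_Suc SK by auto
      fix x y j assume x: "x \<in> ?E i" and y: "y \<in> ?E j"
      have KF: "K \<subseteq> F 1" by (auto simp: K_def)
      have xy1: "x \<in> K" "y \<in> K" using x y SK by (auto split: if_splits)
      then have c: "commutator G x y \<in> F 2 \<inter> S" using KF by (auto simp: K_def)
      show "commutator G x y \<in> ?E (i + j)"
      proof (cases "i + j \<le> 1")
        case True
        then show ?thesis using c SK by auto
      next
        case False
        define i' j' where "i' = max 1 i" and "j' = max 1 j"
        have "x \<in> F i'" "y \<in> F j'" using x y KF by (auto simp: i'_def j'_def max_def split: if_splits)
        then have "commutator G x y \<in> F (i' + j')" by (rule F_commutator)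
        moreover have "F (i' + j') \<subseteq> F (i + j)" by (intro F_antimono) (simp add: i'_def j'_def)
        ultimately show ?thesis using False c by auto
      qed
    qed
    have "p \<ge> 2" using p by (rule prime_ge_2_nat)
    then have "?E p = {\<one>}" using Fp subgroup.one_closed[OF T] by auto
    moreover have "z [^] n = \<one>" if "z \<in> ?E 2" for z using that by (simp add: S_def)
    moreover have "x \<in> ?E 1" "y \<in> ?E 1" using SK Suc.prems by (auto simp: S_def)
    ultimately show ?thesis
      using N_series.mult_pow_eq_one[OF E p n, of x y] Suc.prems by simp
  qed
qed

context group
begin

text \<open>Truncated subtraction puts the whole group in degrees 0 and 1, which supplies
  \<open>F 0 = F 1\<close>, and restores the usual indexing of \<gamma> from 1.\<close>

lemma N_series_lower_central: "N_series G (\<lambda>i. lower_central G (i - 1))"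
proof (intro N_series.intro N_series_axioms.intro group_axioms)
  fix i
  show "subgroup (lower_central G (i - 1)) G" by (rule lower_central_subgroup)
  show "lower_central G (Suc i - 1) \<subseteq> lower_central G (i - 1)" by (intro lower_central_antimono) simp
  fix x y j assume xy: "x \<in> lower_central G (i - 1)" "y \<in> lower_central G (j - 1)"
  have "i + j - 1 \<le> Suc ((i - 1) + (j - 1))" by simp
  with commutator_lower_central[OF xy] lower_central_antimono
  show "commutator G x y \<in> lower_central G (i + j - 1)" by blast
qed

lemma exponent_generate:
  assumes p: "Factorial_Ring.prime p" and n: "n = p ^ e" and cl: "lower_central G (p - 1) = {\<one>}"
    and S: "S \<subseteq> carrier G" "\<And>s. s \<in> S \<Longrightarrow> s [^] n = \<one>" and x: "x \<in> generate G S"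
  shows "x [^] n = \<one>"
  using x
proof (induction rule: generate.induct)
  case (inv h)
  then show ?case using S by (auto simp: nat_pow_inv subset_iff)
next
  case (eng a b)
  have "a \<in> carrier G" "b \<in> carrier G" using eng generate_in_carrier[OF S(1)] by auto
  then show ?case
    using N_series_torsion_mult[OF p n N_series_lower_central, of "p - 1" a b] eng p cl
    by (simp add: prime_gt_0_nat)
qed (use S in simp_all)

end


section \<open>The action on \<open>D(G)\<close>\<close>

lemma (in group_hom) hom_conj_by:
  "x \<in> carrier G \<Longrightarrow> y \<in> carrier G \<Longrightarrow> h (G.conj_by x y) = H.conj_by (h x) (h y)"
  by (simp add: G.conj_by_def H.conj_by_def)

lemma (in group_hom) hom_commutator:
  "x \<in> carrier G \<Longrightarrow> y \<in> carrier G \<Longrightarrow> h (commutator G x y) = commutator H (h x) (h y)"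
  by (simp add: commutator_def)

context group
begin

text \<open>The bounds \<open>V s\<close> are subgroups of the ambient group, and only their traces
  on \<open>H\<close> enter the induction. For \<open>D\<close> they are preimages under the folding
  map.\<close>

lemma subgroup_lower_central_subset:
  assumes H: "subgroup H G" and H0: "H \<subseteq> V 0" and V: "\<And>s. subgroup (V s) G"
    and VS: "\<And>s u v. u \<in> V s \<Longrightarrow> u \<in> H \<Longrightarrow> v \<in> H \<Longrightarrow> commutator G u v \<in> V (Suc s)"
  shows "lower_central (G\<lparr>carrier := H\<rparr>) s \<subseteq> V s"
proof (induction s)
  case (Suc s)
  interpret H: subgroup H G by fact
  interpret GH: group "G\<lparr>carrier := H\<rparr>" by (rule subgroup_imp_group[OF H])
  have comm: "commutator (G\<lparr>carrier := H\<rparr>) u v = commutator G u v" if "u \<in> H" "v \<in> H" for u v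
    using that by (simp add: commutator_def m_inv_consistent[OF H])
  have "subgroup (V (Suc s) \<inter> H) G" by (intro subgroups_Inter_pair V H)
  then have "subgroup (V (Suc s) \<inter> H) (G\<lparr>carrier := H\<rparr>)" by (rule subgroup_incl[OF _ H]) simp
  moreover have "commutator (G\<lparr>carrier := H\<rparr>) u v \<in> V (Suc s) \<inter> H"
    if "u \<in> lower_central (G\<lparr>carrier := H\<rparr>) s" "v \<in> carrier (G\<lparr>carrier := H\<rparr>)" for u v
  proof -
    have "u \<in> H" "v \<in> H" using that GH.lower_central_carrier by auto
    moreover from this have "commutator G u v \<in> H" by (simp add: commutator_def)
    ultimately show ?thesis using VS that(1) Suc.IH comm by auto
  qed
  ultimately have "lower_central (G\<lparr>carrier := H\<rparr>) (Suc s) \<subseteq> V (Suc s) \<inter> H"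
    unfolding lower_central.simps by (rule GH.commutator_subgroup_least)
  then show ?case by blast
qed (use H0 in simp)

lemma exponent_generate_subgroup:
  assumes p: "Factorial_Ring.prime p" and n: "n = p ^ e" and S: "S \<subseteq> carrier G"
    and cl: "lower_central (G\<lparr>carrier := generate G S\<rparr>) (p - 1) = {\<one>}"
    and exp: "\<And>s. s \<in> S \<Longrightarrow> s [^] n = \<one>" and x: "x \<in> generate G S"
  shows "x [^] n = \<one>"
proof -
  note H = generate_is_subgroup[OF S]
  have SH: "S \<subseteq> generate G S" by (auto intro: generate.incl)
  interpret GH: group "G\<lparr>carrier := generate G S\<rparr>" by (rule subgroup_imp_group[OF H])
  have "x [^]\<^bsub>G\<lparr>carrier := generate G S\<rparr>\<^esub> n = \<one>\<^bsub>G\<lparr>carrier := generate G S\<rparr>\<^esub>"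
    by (rule GH.exponent_generate[OF p n, of S])
      (use cl exp x SH in \<open>simp_all add: nat_pow_consistent[symmetric] generate_consistent[OF SH H]\<close>)
  then show ?thesis by (simp add: nat_pow_consistent[symmetric])
qed

end

text \<open>\<open>C\<close> is \<open>\<chi>(G)\<close>, with \<open>l\<close> and \<open>r\<close> the embeddings of \<open>G\<close> and \<open>G\<^sup>\<phi>\<close> and \<open>q\<close> the folding map.\<close>

locale weak_commutativity = group C + G: group G
  for C :: "('b, 'n) monoid_scheme" (structure) and G :: "('a, 'm) monoid_scheme" +
  fixes l r :: "'a \<Rightarrow> 'b" and q :: "'b \<Rightarrow> 'a"
  assumes l_hom: "l \<in> hom G C" and r_hom: "r \<in> hom G C" and q_hom: "q \<in> hom C G"
    and q_l [simp]: "g \<in> carrier G \<Longrightarrow> q (l g) = g"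
    and q_r [simp]: "g \<in> carrier G \<Longrightarrow> q (r g) = g"
    and l_r_commutator: "g \<in> carrier G \<Longrightarrow> commutator C (l g) (r g) = \<one>"
    and carrier_generate: "carrier C = generate C (l ` carrier G \<union> r ` carrier G)"
begin

sublocale l: group_hom G C l by unfold_locales (rule l_hom)
sublocale r: group_hom G C r by unfold_locales (rule r_hom)
sublocale q: group_hom C G q by unfold_locales (rule q_hom)

definition D :: "'b set" where
  "D = commutator_subgroup C (l ` carrier G) (r ` carrier G)"

lemma carrier_induct [consumes 1, case_names left right mult]:
  assumes x: "x \<in> carrier C" and l: "\<And>z. z \<in> carrier G \<Longrightarrow> P (l z)"
    and r: "\<And>z. z \<in> carrier G \<Longrightarrow> P (r z)"
    and m: "\<And>x y. x \<in> carrier C \<Longrightarrow> y \<in> carrier C \<Longrightarrow> P x \<Longrightarrow> P y \<Longrightarrow> P (x \<otimes> y)"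
  shows "P x"
proof -
  have "x \<in> generate C (l ` carrier G \<union> r ` carrier G)" using x carrier_generate by simp
  then show ?thesis
  proof (induction rule: generate.induct)
    case one
    show ?case using l[of "\<one>\<^bsub>G\<^esub>"] by simp
  next
    case (inv h)
    then obtain z where "z \<in> carrier G" "h = l z \<or> h = r z" by blast
    then show ?case using l[of "inv\<^bsub>G\<^esub> z"] r[of "inv\<^bsub>G\<^esub> z"] by auto
  next
    case (eng a b)
    then show ?case using m carrier_generate by blast
  qed (use l r in auto)
qed

lemma normalI_carrier:
  assumes N: "subgroup N C" and l: "\<And>x z. x \<in> N \<Longrightarrow> z \<in> carrier G \<Longrightarrow> conj_by x (l z) \<in> N"
    and r: "\<And>x z. x \<in> N \<Longrightarrow> z \<in> carrier G \<Longrightarrow> conj_by x (r z) \<in> N"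
  shows "N \<lhd> C"
proof (rule normalI_conj_by[OF N])
  fix x g assume "x \<in> N" "g \<in> carrier C"
  from this(2,1) show "conj_by x g \<in> N"
  proof (induction arbitrary: x rule: carrier_induct)
    case (mult a b)
    then have "conj_by (conj_by x a) b \<in> N" by blast
    with mult show ?case using subgroup.mem_carrier[OF N] by (simp add: conj_by_conj_by)
  qed (use l r in auto)
qed

section \<open>Consequences of the defining relations\<close>

lemma conj_by_r_l: "g \<in> carrier G \<Longrightarrow> conj_by (l g) (r g) = l g"
  and conj_by_l_r: "g \<in> carrier G \<Longrightarrow> conj_by (r g) (l g) = r g"
proof -
  assume g: "g \<in> carrier G"
  then show "conj_by (l g) (r g) = l g" by (simp add: conj_by_commutator l_r_commutator)
  have "commutator C (r g) (l g) = \<one>"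
    using inv_commutator[of "l g" "r g"] g by (simp add: l_r_commutator)
  with g show "conj_by (r g) (l g) = r g" by (simp add: conj_by_commutator)
qed

text \<open>Expanding \<open>[g h, (g h)\<^sup>\<phi>] = 1\<close> gives
  \<open>[g, h\<^sup>\<phi>]^h = [g\<^sup>\<phi>, h]^(h\<^sup>\<phi>)\<close>. As \<open>h\<close>
  and \<open>h\<^sup>\<phi>\<close> commute, this is the claim for \<open>g^h\<close> in place of
  \<open>g\<close>, and every element has that form.\<close>

lemma commutator_swap:
  assumes g: "g \<in> carrier G" and h: "h \<in> carrier G"
  shows "commutator C (l g) (r h) = commutator C (r g) (l h)"
proof -
  have *: "commutator C (l (G.conj_by g h)) (r h) = commutator C (r (G.conj_by g h)) (l h)"
    if g: "g \<in> carrier G" for g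
  proof -
    have "\<one> = commutator C (l (g \<otimes>\<^bsub>G\<^esub> h)) (r (g \<otimes>\<^bsub>G\<^esub> h))"
      using g h by (simp only: l_r_commutator G.m_closed)
    also have "\<dots> = conj_by (commutator C (l g) (r h)) (l h) \<otimes>
        conj_by (commutator C (l h) (r g)) (r h)"
      using g h by (simp add: commutator_mult_left commutator_mult_right l_r_commutator)
    finally have "conj_by (commutator C (l g) (r h)) (l h) =
        inv (conj_by (commutator C (l h) (r g)) (r h))"
      using g h by (intro inv_equality[symmetric]) simp_all
    also have "\<dots> = conj_by (commutator C (r g) (l h)) (r h)"
      using g h by (simp add: conj_by_inv[symmetric] inv_commutator)
    finally show ?thesis
      using g h
      by (simp add: conj_by_commutator_distrib l.hom_conj_by r.hom_conj_by conj_by_r_l conj_by_l_r)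
  qed
  from *[of "G.conj_by g (inv\<^bsub>G\<^esub> h)"] show ?thesis
    using g h by (simp add: G.conj_by_conj_by)
qed

text \<open>\<open>[g z, h\<^sup>\<phi>]\<close> equals \<open>[(g z)\<^sup>\<phi>, h]\<close>; both
  are expanded in the first entry and the common right factor \<open>[z, h\<^sup>\<phi>]\<close> is
  cancelled.\<close>

lemma conj_by_generator:
  assumes "g \<in> carrier G" "h \<in> carrier G" "z \<in> carrier G"
  shows "conj_by (commutator C (l g) (r h)) (l z) = conj_by (commutator C (l g) (r h)) (r z)"
proof -
  have "conj_by (commutator C (l g) (r h)) (l z) \<otimes> commutator C (l z) (r h) =
      commutator C (l (g \<otimes>\<^bsub>G\<^esub> z)) (r h)"
    using assms by (simp add: commutator_mult_left)
  also have "\<dots> = commutator C (r (g \<otimes>\<^bsub>G\<^esub> z)) (l h)"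
    using assms by (intro commutator_swap) auto
  also have "\<dots> = conj_by (commutator C (r g) (l h)) (r z) \<otimes> commutator C (r z) (l h)"
    using assms by (simp add: commutator_mult_left)
  also have "\<dots> = conj_by (commutator C (l g) (r h)) (r z) \<otimes> commutator C (l z) (r h)"
    using assms by (simp add: commutator_swap)
  finally show ?thesis using assms by (simp add: r_cancel)
qed

section \<open>The normal subgroup \<open>D\<close> and the action on it\<close>

lemma generators_carrier:
  "{commutator C x y | x y. x \<in> l ` carrier G \<and> y \<in> r ` carrier G} \<subseteq> carrier C"
  by auto

lemma D_subgroup: "subgroup D C"
  unfolding D_def by (rule commutator_subgroup_is_subgroup) auto

lemma D_carrier: "d \<in> D \<Longrightarrow> d \<in> carrier C"
  using subgroup.mem_carrier[OF D_subgroup] .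

lemma generator_D: "g \<in> carrier G \<Longrightarrow> h \<in> carrier G \<Longrightarrow> commutator C (l g) (r h) \<in> D"
  unfolding D_def by (rule commutator_subgroup_mem) auto

lemma conj_by_l_D:
  assumes d: "d \<in> D" and z: "z \<in> carrier G"
  shows "conj_by d (l z) = conj_by d (r z)"
proof -
  have "subgroup {d \<in> carrier C. conj_by d (l z) = conj_by d (r z)} C"
    using z by (intro subgroupI) (auto simp: conj_by_mult conj_by_inv intro!: exI[of _ \<one>])
  then have "D \<subseteq> {d \<in> carrier C. conj_by d (l z) = conj_by d (r z)}"
    unfolding D_def using z by (intro commutator_subgroup_least) (auto simp: conj_by_generator)
  with d show ?thesis by blast
qed

text \<open>\<open>[g, h\<^sup>\<phi>]^z = [g z, h\<^sup>\<phi>] [z, h\<^sup>\<phi>]^-1\<close>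
  handles the first copy, and \<open>conj_by_l_D\<close> transfers this to the second.\<close>

lemma D_normal: "D \<lhd> C"
proof -
  have l: "conj_by d (l z) \<in> D" if "d \<in> D" "z \<in> carrier G" for d z
    using that(1) unfolding D_def commutator_subgroup_def
  proof (rule generate_conj_by_closed[OF generators_carrier _ _, rotated 2])
    show "l z \<in> carrier C" using that by simp
    fix s assume "s \<in> {commutator C x y | x y. x \<in> l ` carrier G \<and> y \<in> r ` carrier G}"
    then obtain g h where s: "s = commutator C (l g) (r h)" and gh: "g \<in> carrier G" "h \<in> carrier G"
      by auto
    have "conj_by s (l z) = commutator C (l (g \<otimes>\<^bsub>G\<^esub> z)) (r h) \<otimes> inv (commutator C (l z) (r h))"
      using gh that by (simp add: s commutator_mult_left m_assoc)
    also have "\<dots> \<in> D"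
      using gh that
      by (intro subgroup.m_closed[OF D_subgroup] subgroup.m_inv_closed[OF D_subgroup] generator_D) auto
    finally show "conj_by s (l z) \<in>
        generate C {commutator C x y | x y. x \<in> l ` carrier G \<and> y \<in> r ` carrier G}"
      by (simp add: D_def commutator_subgroup_def)
  qed
  then show ?thesis
    by (intro normalI_carrier D_subgroup) (auto simp flip: conj_by_l_D)
qed

lemma conj_by_D: "d \<in> D \<Longrightarrow> x \<in> carrier C \<Longrightarrow> conj_by d x \<in> D"
  by (rule normal_conj_by[OF D_normal])

lemma conj_by_D_q:
  assumes "x \<in> carrier C" "d \<in> D"
  shows "conj_by d x = conj_by d (r (q x))"
  using assms
proof (induction arbitrary: d rule: carrier_induct)
  case (mult x y)
  have "conj_by d (x \<otimes> y) = conj_by (conj_by d x) y"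
    using mult(1,2,5) D_carrier by (simp add: conj_by_conj_by)
  also have "\<dots> = conj_by (conj_by d x) (r (q y))" using mult conj_by_D by blast
  also have "\<dots> = conj_by (conj_by d (r (q x))) (r (q y))" using mult by simp
  finally show ?case using mult(1,2,5) D_carrier by (simp add: conj_by_conj_by)
qed (simp_all add: conj_by_l_D)

lemma lower_central_D:
  assumes c: "lower_central G c = {\<one>\<^bsub>G\<^esub>}" and c0: "c > 0"
  shows "lower_central (C\<lparr>carrier := D\<rparr>) c = {\<one>}"
proof -
  \<comment> \<open>\<open>D\<close> maps into the derived group, so the images of its terms lie one
    step deeper. At \<open>Suc s = c\<close> the preimage is the kernel of \<open>q\<close>, which
    centralizes \<open>D\<close>; hence the next bound can be trivial.\<close>
  define V where
    "V s = (if s < c then {x \<in> carrier C. q x \<in> lower_central G (Suc s)} else {\<one>})" for s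
  have sub: "subgroup {x \<in> carrier C. q x \<in> lower_central G (Suc s)} C" for s
  proof (rule subgroupI)
    have "\<one> \<in> {x \<in> carrier C. q x \<in> lower_central G (Suc s)}"
      using subgroup.one_closed[OF G.lower_central_subgroup] by (simp del: lower_central.simps)
    then show "{x \<in> carrier C. q x \<in> lower_central G (Suc s)} \<noteq> {}" by blast
  qed (auto simp del: lower_central.simps intro: subgroup.m_closed[OF G.lower_central_subgroup]
      subgroup.m_inv_closed[OF G.lower_central_subgroup])
  have D1: "D \<subseteq> {x \<in> carrier C. q x \<in> lower_central G (Suc 0)}"
    unfolding D_def
    by (intro commutator_subgroup_least sub)
      (auto simp: q.hom_commutator G.commutator_subgroup_mem)
  have "lower_central (C\<lparr>carrier := D\<rparr>) c \<subseteq> V c"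
  proof (rule subgroup_lower_central_subset[OF D_subgroup])
    show "D \<subseteq> V 0" using D1 c0 by (simp add: V_def)
    show "subgroup (V s) C" for s using sub triv_subgroup by (simp add: V_def)
    fix s u v assume u: "u \<in> V s" "u \<in> D" and v: "v \<in> D"
    have uv: "u \<in> carrier C" "v \<in> carrier C" using u v D_carrier by auto
    show "commutator C u v \<in> V (Suc s)"
    proof (cases "Suc s < c")
      case True
      then have "commutator G (q u) (q v) \<in> lower_central G (Suc (Suc s))"
        using u uv by (intro G.commutator_lower_central_carrier) (auto simp: V_def)
      then show ?thesis using True uv by (simp add: V_def q.hom_commutator del: lower_central.simps)
    next
      case False
      have "q u = \<one>\<^bsub>G\<^esub>"
      proof (cases "s < c")
        case True
        with False have "c = Suc s" by simp
        then show ?thesis using u c by (simp add: V_def)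
      qed (use u in \<open>simp add: V_def\<close>)
      then have "commutator C v u = \<one>"
        using conj_by_D_q[of u v] v uv by (simp add: commutator_eq_one)
      then have "commutator C u v = \<one>"
        using inv_commutator[of v u] uv by simp
      then show ?thesis using False by (simp add: V_def)
    qed
  qed
  moreover have "\<one> \<in> lower_central (C\<lparr>carrier := D\<rparr>) c"
    using subgroup.one_closed[OF group.lower_central_subgroup[OF subgroup_imp_group[OF D_subgroup]]]
    by simp
  ultimately show ?thesis by (auto simp: V_def)
qed

lemma pow_mod_D:
  assumes x: "x \<in> carrier C" and exp: "\<And>g. g \<in> carrier G \<Longrightarrow> g [^]\<^bsub>G\<^esub> (n::nat) = \<one>\<^bsub>G\<^esub>"
  shows "x [^] n \<in> D"
proof -
  interpret D: subgroup D C by (rule D_subgroup)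
  \<comment> \<open>Moving \<open>l a'\<close> to the left past \<open>r b\<close> and
    \<open>d\<close> leaves \<open>[r b, l a']\<close>, which is in \<open>D\<close> by
    \<open>commutator_swap\<close>. Modulo \<open>D\<close> the two coordinates thus multiply
    independently.\<close>
  have *: "l a \<otimes> (r b \<otimes> d) \<otimes> (l a' \<otimes> (r b' \<otimes> d')) =
      l (a \<otimes>\<^bsub>G\<^esub> a') \<otimes> (r (b \<otimes>\<^bsub>G\<^esub> b') \<otimes>
        (conj_by (commutator C (r b) (l a') \<otimes> conj_by d (l a')) (r b') \<otimes> d'))"
    if "a \<in> carrier G" "b \<in> carrier G" "a' \<in> carrier G" "b' \<in> carrier G"
      "d \<in> carrier C" "d' \<in> carrier C" for a b a' b' d d'
    using that by (simp add: commutator_def conj_by_def word_simps)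
  have mult_D: "conj_by (commutator C (r b) (l a') \<otimes> conj_by d (l a')) (r b') \<otimes> d' \<in> D"
    if "b \<in> carrier G" "a' \<in> carrier G" "b' \<in> carrier G" "d \<in> D" "d' \<in> D" for b a' b' d d'
    using that by (intro D.m_closed conj_by_D) (auto simp flip: commutator_swap intro: generator_D)
  have "\<exists>a\<in>carrier G. \<exists>b\<in>carrier G. \<exists>d\<in>D. x = l a \<otimes> (r b \<otimes> d)"
    using x
  proof (induction rule: carrier_induct)
    case (left z)
    then show ?case by (intro bexI[of _ z] bexI[of _ "\<one>\<^bsub>G\<^esub>"] bexI[of _ \<one>]) auto
  next
    case (right z)
    then show ?case by (intro bexI[of _ "\<one>\<^bsub>G\<^esub>"] bexI[of _ z] bexI[of _ \<one>]) auto
  next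
    case (mult x y)
    then obtain a b d a' b' d' where ab: "a \<in> carrier G" "b \<in> carrier G" "d \<in> D"
        "a' \<in> carrier G" "b' \<in> carrier G" "d' \<in> D"
      and "x = l a \<otimes> (r b \<otimes> d)" "y = l a' \<otimes> (r b' \<otimes> d')"
      by blast
    then show ?case
      using *[of a b a' b' d d'] mult_D[of b a' b' d d'] D_carrier by blast
  qed
  then obtain a b d where ab: "a \<in> carrier G" "b \<in> carrier G" "d \<in> D"
    and x: "x = l a \<otimes> (r b \<otimes> d)"
    by blast
  have "\<exists>d'\<in>D. x [^] m = l (a [^]\<^bsub>G\<^esub> m) \<otimes> (r (b [^]\<^bsub>G\<^esub> m) \<otimes> d')" for m :: nat
  proof (induction m)
    case 0
    then show ?case by (intro bexI[of _ \<one>]) auto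
  next
    case (Suc m)
    then obtain d' where "d' \<in> D" "x [^] m = l (a [^]\<^bsub>G\<^esub> m) \<otimes> (r (b [^]\<^bsub>G\<^esub> m) \<otimes> d')"
      by blast
    then have "x [^] Suc m = l (a [^]\<^bsub>G\<^esub> m) \<otimes> (r (b [^]\<^bsub>G\<^esub> m) \<otimes> d') \<otimes> (l a \<otimes> (r b \<otimes> d))"
      by (simp add: x)
    then show ?case
      using * mult_D ab \<open>d' \<in> D\<close> D_carrier by (metis G.nat_pow_Suc G.nat_pow_closed)
  qed
  then obtain d' where "d' \<in> D" "x [^] n = l (a [^]\<^bsub>G\<^esub> n) \<otimes> (r (b [^]\<^bsub>G\<^esub> n) \<otimes> d')"
    by blast
  then show ?thesis using exp ab by simp
qed

end


section \<open>Exponents\<close>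

lemma (in group) group_exponent_dvd:
  assumes n: "n > 0" and exp: "\<And>x. x \<in> carrier G \<Longrightarrow> x [^] n = \<one>"
  shows "group_exponent G dvd n"
proof -
  let ?P = "\<lambda>m. m > 0 \<and> (\<forall>x\<in>carrier G. x [^] (m::nat) = \<one>)"
  define k where "k = (LEAST m. ?P m)"
  have "?P k" unfolding k_def using assms by (intro LeastI[of ?P n]) auto
  then have k: "k > 0" "\<And>x. x \<in> carrier G \<Longrightarrow> x [^] k = \<one>" by auto
  have "x [^] (n mod k) = \<one>" if "x \<in> carrier G" for x
  proof -
    have "x [^] n = (x [^] k) [^] (n div k) \<otimes> x [^] (n mod k)"
      using that by (simp add: nat_pow_pow nat_pow_mult)
    then show ?thesis using that k exp by simp
  qed
  moreover have "n mod k < k" using k by simp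
  ultimately have "n mod k = 0"
    using not_less_Least[of "n mod k" ?P] by (auto simp: k_def)
  moreover have "\<exists>m>0. \<forall>x\<in>carrier G. x [^] (m::nat) = \<one>" using assms by blast
  then have "group_exponent G = k" by (simp add: group_exponent_def k_def)
  ultimately show ?thesis by (simp add: dvd_eq_mod_eq_0)
qed

lemma (in group) finite_group_exponent:
  assumes fin: "finite (carrier G)"
  shows "group_exponent G > 0" "group_exponent G dvd order G"
    "x \<in> carrier G \<Longrightarrow> x [^] group_exponent G = \<one>"
proof -
  have o: "order G > 0" "\<And>x. x \<in> carrier G \<Longrightarrow> x [^] order G = \<one>"
    using fin order_gt_0_iff_finite pow_order_eq_1 by auto
  let ?P = "\<lambda>m. m > 0 \<and> (\<forall>x\<in>carrier G. x [^] (m::nat) = \<one>)"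
  have "?P (LEAST m. ?P m)" using o by (intro LeastI[of ?P "order G"]) auto
  moreover have "\<exists>m>0. \<forall>x\<in>carrier G. x [^] (m::nat) = \<one>" using o by blast
  then have "group_exponent G = (LEAST m. ?P m)" by (simp add: group_exponent_def)
  ultimately show "group_exponent G > 0" "x \<in> carrier G \<Longrightarrow> x [^] group_exponent G = \<one>"
    by auto
  show "group_exponent G dvd order G" using o by (rule group_exponent_dvd)
qed

section \<open>The subgroups \<open>N\<close> and \<open>M\<close> of a fixed element\<close>

context weak_commutativity
begin

text \<open>As \<open>lower_central\<close> is indexed from 0, \<open>M g t\<close> is the \<open>M\<^sub>t\<^sub>+\<^sub>1\<close> of the introduction.\<close>

definition M :: "'a \<Rightarrow> nat \<Rightarrow> 'b set" where
  "M g t = generate C {conj_by (commutator C (l g) (r m)) (r x) | m x.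
    m \<in> lower_central G t \<and> x \<in> carrier G}"

definition N :: "'a \<Rightarrow> 'b set" where
  "N g = generate C {conj_by (l g) (r x) | x. x \<in> carrier G}"

context
  fixes g assumes g: "g \<in> carrier G"
begin

lemma M_gens_carrier:
  "{conj_by (commutator C (l g) (r m)) (r x) | m x. m \<in> lower_central G t \<and> x \<in> carrier G}
    \<subseteq> carrier C"
  using g G.lower_central_carrier by auto

lemma N_gens_carrier: "{conj_by (l g) (r x) | x. x \<in> carrier G} \<subseteq> carrier C"
  using g by auto

lemma M_subgroup: "subgroup (M g t) C"
  unfolding M_def by (rule generate_is_subgroup[OF M_gens_carrier])

lemma N_subgroup: "subgroup (N g) C"
  unfolding N_def by (rule generate_is_subgroup[OF N_gens_carrier])

lemma M_gen:
  "m \<in> lower_central G t \<Longrightarrow> x \<in> carrier G \<Longrightarrow>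
    conj_by (commutator C (l g) (r m)) (r x) \<in> M g t"
  unfolding M_def by (blast intro: generate.incl)

lemma M_commutator: "m \<in> lower_central G t \<Longrightarrow> commutator C (l g) (r m) \<in> M g t"
  using M_gen[of m t "\<one>\<^bsub>G\<^esub>"] g G.lower_central_carrier by simp

lemma M_D: "M g t \<subseteq> D"
  unfolding M_def using g G.lower_central_carrier
  by (intro generate_subgroup_incl D_subgroup) (auto intro!: conj_by_D generator_D)

text \<open>Stability under \<open>r\<close> is built into the generators. As \<open>M g t\<close>
  lies in \<open>D\<close>, where \<open>l z\<close> and \<open>r z\<close> act alike, stability
  under \<open>l\<close> follows.\<close>

lemma M_normal: "M g t \<lhd> C"
proof -
  have r: "conj_by d (r z) \<in> M g t" if "d \<in> M g t" "z \<in> carrier G" for d z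
    using that(1) unfolding M_def
  proof (rule generate_conj_by_closed[OF M_gens_carrier _ _, rotated 2])
    show "r z \<in> carrier C" using that by simp
    fix s assume "s \<in> {conj_by (commutator C (l g) (r m)) (r x) | m x.
      m \<in> lower_central G t \<and> x \<in> carrier G}"
    then obtain m x where "s = conj_by (commutator C (l g) (r m)) (r x)"
      and mx: "m \<in> lower_central G t" "x \<in> carrier G" by blast
    then have "conj_by s (r z) = conj_by (commutator C (l g) (r m)) (r (x \<otimes>\<^bsub>G\<^esub> z))"
      using that g G.lower_central_carrier by (simp add: conj_by_conj_by)
    also have "\<dots> \<in> M g t" using mx that by (intro M_gen) auto
    finally show "conj_by s (r z) \<in> generate C {conj_by (commutator C (l g) (r m)) (r x) | m x.
      m \<in> lower_central G t \<and> x \<in> carrier G}" by (simp add: M_def)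
  qed
  show ?thesis
    using r conj_by_l_D M_D by (intro normalI_carrier M_subgroup) (auto simp: subset_iff)
qed

lemma N_gen: "x \<in> carrier G \<Longrightarrow> conj_by (l g) (r x) \<in> N g"
  unfolding N_def by (blast intro: generate.incl)

lemma commutator_l_r_N:
  assumes x: "x \<in> carrier G"
  shows "commutator C (l g) (r x) \<in> N g"
proof -
  interpret N: subgroup "N g" C by (rule N_subgroup)
  have "l g \<in> N g" using N_gen[of "\<one>\<^bsub>G\<^esub>"] g by simp
  then show ?thesis using N_gen[OF x] g x by (simp add: commutator_conj_by)
qed

text \<open>Writing \<open>y = y'^x\<close> with \<open>y'\<close> in the same term pulls the
  conjugation out: \<open>[g^(x\<^sup>\<phi>), y\<^sup>\<phi>] =
  [g, y'\<^sup>\<phi>]^(x\<^sup>\<phi>)\<close>.\<close>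

lemma commutator_N_r:
  assumes u: "u \<in> N g" and y: "y \<in> lower_central G t"
  shows "commutator C u (r y) \<in> M g t"
proof -
  let ?H = "{u \<in> carrier C. \<forall>w \<in> r ` lower_central G t. commutator C u w \<in> M g t}"
  have "subgroup ?H C"
    using G.lower_central_carrier
    by (intro subgroup_commute_mod M_subgroup subgroup_self) (auto intro: normal_conj_by[OF M_normal])
  moreover have "commutator C (conj_by (l g) (r x)) (r y) \<in> M g t"
    if x: "x \<in> carrier G" and y: "y \<in> lower_central G t" for x y
  proof -
    have yc: "y \<in> carrier G" using y by (rule G.lower_central_carrier)
    define y' where "y' = G.conj_by y (inv\<^bsub>G\<^esub> x)"
    have y': "y' \<in> lower_central G t" unfolding y'_def
      using G.normal_conj_by[OF G.lower_central_normal y] x by simp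
    then have y'c: "y' \<in> carrier G" by (rule G.lower_central_carrier)
    have "y = G.conj_by y' x" unfolding y'_def using x yc by (simp add: G.conj_by_conj_by)
    then have "commutator C (conj_by (l g) (r x)) (r y) =
        conj_by (commutator C (l g) (r y')) (r x)"
      using g x y'c by (simp add: r.hom_conj_by conj_by_commutator_distrib)
    with M_gen[OF y' x] show ?thesis by simp
  qed
  ultimately have "N g \<subseteq> ?H"
    unfolding N_def using g by (intro generate_subgroup_incl) auto
  with u y show ?thesis by blast
qed

text \<open>On \<open>d = [g, m\<^sup>\<phi>]\<close> the element \<open>g\<close> acts as
  \<open>g\<^sup>\<phi>\<close>, which fixes \<open>g\<close> and turns \<open>m\<close> into
  \<open>m k\<close> with \<open>k = [m, g]\<close> one term deeper. Comparison with
  \<open>d\<close> leaves only factors involving \<open>k\<^sup>\<phi>\<close>.\<close>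

lemma commutator_M_l:
  assumes m: "m \<in> lower_central G t"
  shows "commutator C (commutator C (l g) (r m)) (l g) \<in> M g (Suc t)"
proof -
  interpret M: subgroup "M g (Suc t)" C by (rule M_subgroup)
  have mc: "m \<in> carrier G" using m by (rule G.lower_central_carrier)
  define d where "d = commutator C (l g) (r m)"
  define k where "k = commutator G m g"
  have k: "k \<in> lower_central G (Suc t)"
    unfolding k_def using m g by (rule G.commutator_lower_central_carrier)
  then have kc: "k \<in> carrier G" by (rule G.lower_central_carrier)
  have dc: "d \<in> carrier C" using g mc by (simp add: d_def)
  have "conj_by d (l g) = conj_by d (r g)"
    unfolding d_def using g mc by (intro conj_by_l_D generator_D)
  also have "\<dots> = commutator C (l g) (r (m \<otimes>\<^bsub>G\<^esub> k))"
    unfolding d_def k_def using g mc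
    by (simp add: conj_by_commutator_distrib conj_by_r_l G.conj_by_commutator[symmetric]
        r.hom_conj_by del: r.hom_mult)
  also have "\<dots> = commutator C (l g) (r k) \<otimes> conj_by d (r k)"
    unfolding d_def using g mc kc by (simp add: commutator_mult_right)
  finally have "commutator C d (l g) = conj_by (commutator C (l g) (r k)) d \<otimes> commutator C d (r k)"
    using dc g kc by (simp add: commutator_conj_by) (simp add: conj_by_def commutator_def word_simps)
  moreover have "conj_by (commutator C (l g) (r k)) d \<in> M g (Suc t)"
    using normal_conj_by[OF M_normal M_commutator[OF k] dc] .
  moreover have "commutator C d (r k) \<in> M g (Suc t)"
    unfolding d_def by (intro commutator_N_r commutator_l_r_N mc k)
  ultimately show ?thesis by (simp add: d_def)
qed

text \<open>The left entry acts on \<open>D\<close> through its image \<open>[g, m]\<close> under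
  \<open>q\<close>, one term deeper than \<open>m\<close>. As the right entry lies in both
  \<open>D\<close> and \<open>N g\<close>, \<open>commutator_N_r\<close> applies.\<close>

lemma commutator_M_commutator:
  assumes m: "m \<in> lower_central G t" and x: "x \<in> carrier G"
  shows "commutator C (commutator C (l g) (r m)) (commutator C (l g) (r x)) \<in> M g (Suc t)"
proof (rule commutator_swap_mem[OF M_subgroup])
  have mc: "m \<in> carrier G" using m by (rule G.lower_central_carrier)
  let ?d = "commutator C (l g) (r m)" and ?e = "commutator C (l g) (r x)"
  show c: "?e \<in> carrier C" "?d \<in> carrier C" using g x mc by auto
  have "commutator C ?e ?d = commutator C ?e (r (q ?d))"
    using conj_by_D_q[of ?d ?e] c g x mc generator_D by (simp add: commutator_conj_by)
  also have "q ?d = commutator G g m" using g mc by (simp add: q.hom_commutator)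
  finally show "commutator C ?e ?d \<in> M g (Suc t)"
    using commutator_N_r[OF commutator_l_r_N[OF x] G.commutator_carrier_lower_central[OF g m]]
    by simp
qed

lemma commutator_M_gen:
  assumes m: "m \<in> lower_central G t" and x: "x \<in> carrier G"
  shows "commutator C (commutator C (l g) (r m)) (conj_by (l g) (r x)) \<in> M g (Suc t)"
proof -
  interpret M: subgroup "M g (Suc t)" C by (rule M_subgroup)
  have mc: "m \<in> carrier G" using m by (rule G.lower_central_carrier)
  have "commutator C (commutator C (l g) (r m)) (conj_by (l g) (r x)) =
      commutator C (commutator C (l g) (r m)) (commutator C (l g) (r x)) \<otimes>
      conj_by (commutator C (commutator C (l g) (r m)) (l g)) (commutator C (l g) (r x))"
    using g mc x by (simp add: conj_by_commutator commutator_mult_right)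
  then show ?thesis
    using commutator_M_commutator[OF m x] normal_conj_by[OF M_normal commutator_M_l[OF m]] g x by simp
qed

text \<open>Pulling out a common conjugation by \<open>r x\<close> reduces a pair of generators to
  the case of \<open>commutator_M_gen\<close>, with \<open>y x^-1\<close> as the remaining
  conjugator.\<close>

lemma commutator_M_N:
  assumes u: "u \<in> M g t" and v: "v \<in> N g"
  shows "commutator C u v \<in> M g (Suc t)"
proof (rule commutator_generate_normal[OF M_normal M_gens_carrier N_gens_carrier _
      u[unfolded M_def] v[unfolded N_def]])
  fix s w
  assume "s \<in> {conj_by (commutator C (l g) (r m)) (r x) | m x.
      m \<in> lower_central G t \<and> x \<in> carrier G}"
    and "w \<in> {conj_by (l g) (r x) | x. x \<in> carrier G}"
  then obtain m x y where s: "s = conj_by (commutator C (l g) (r m)) (r x)"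
    and w: "w = conj_by (l g) (r y)"
    and m: "m \<in> lower_central G t" and x: "x \<in> carrier G" and y: "y \<in> carrier G" by blast
  have mc: "m \<in> carrier G" using m by (rule G.lower_central_carrier)
  define z where "z = y \<otimes>\<^bsub>G\<^esub> inv\<^bsub>G\<^esub> x"
  have z: "z \<in> carrier G" using x y by (simp add: z_def)
  have "y = z \<otimes>\<^bsub>G\<^esub> x" using x y by (simp add: z_def G.m_assoc)
  then have "w = conj_by (conj_by (l g) (r z)) (r x)"
    using g x z by (simp add: w conj_by_conj_by)
  then have "commutator C s w =
      conj_by (commutator C (commutator C (l g) (r m)) (conj_by (l g) (r z))) (r x)"
    using g x z mc by (simp add: s conj_by_commutator_distrib)
  also have "\<dots> \<in> M g (Suc t)"
    using normal_conj_by[OF M_normal commutator_M_gen[OF m z]] x by simp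
  finally show "commutator C s w \<in> M g (Suc t)" .
qed

text \<open>Here \<open>s = g [g, x\<^sup>\<phi>]\<close>, and \<open>[w, g]\<close> reduces to
  \<open>[[g, y\<^sup>\<phi>], g]\<close> since \<open>[g, g] = 1\<close>. The previous lemmas with
  \<open>t = 0\<close>, where the term is all of \<open>G\<close>, cover both factors.\<close>

lemma commutator_N_N:
  assumes u: "u \<in> N g" and v: "v \<in> N g"
  shows "commutator C u v \<in> M g (Suc 0)"
proof (rule commutator_generate_normal[OF M_normal N_gens_carrier N_gens_carrier _
      u[unfolded N_def] v[unfolded N_def]])
  interpret M: subgroup "M g (Suc 0)" C by (rule M_subgroup)
  fix s w
  assume "s \<in> {conj_by (l g) (r x) | x. x \<in> carrier G}"
    and "w \<in> {conj_by (l g) (r x) | x. x \<in> carrier G}"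
  then obtain x y where s: "s = conj_by (l g) (r x)" and w: "w = conj_by (l g) (r y)"
    and x: "x \<in> carrier G" and y: "y \<in> carrier G" by blast
  have 1: "commutator C (commutator C (l g) (r x)) w \<in> M g (Suc 0)"
    unfolding w using x y by (intro commutator_M_gen) auto
  have "commutator C w (l g) = commutator C (commutator C (l g) (r y)) (l g)"
    using g y by (simp add: w conj_by_commutator commutator_mult_left)
  also have "\<dots> \<in> M g (Suc 0)" using y by (intro commutator_M_l) auto
  finally have 2: "commutator C (l g) w \<in> M g (Suc 0)"
    using g y w by (intro commutator_swap_mem[OF M_subgroup, of w "l g"]) auto
  have "commutator C s w =
      conj_by (commutator C (l g) w) (commutator C (l g) (r x)) \<otimes>
      commutator C (commutator C (l g) (r x)) w"
    using g x y by (simp add: s w conj_by_commutator[of "l g" "r x"] commutator_mult_left)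
  then show "commutator C s w \<in> M g (Suc 0)"
    using 1 normal_conj_by[OF M_normal 2] g x by simp
qed

lemma lower_central_N:
  assumes c: "lower_central G c = {\<one>\<^bsub>G\<^esub>}" and c0: "c > 0"
  shows "lower_central (C\<lparr>carrier := N g\<rparr>) c = {\<one>}"
proof -
  \<comment> \<open>\<open>N g\<close> stands in degree 0 in place of \<open>M g 0\<close>: since
    \<open>[N, N]\<close> already lies in \<open>M g 1\<close>, the bound on the class is
    \<open>c\<close> and not \<open>c + 1\<close>.\<close>
  have "lower_central (C\<lparr>carrier := N g\<rparr>) c \<subseteq> (if c = 0 then N g else M g c)"
  proof (rule subgroup_lower_central_subset[OF N_subgroup])
    fix s u v assume u: "u \<in> (if s = 0 then N g else M g s)" "u \<in> N g" and v: "v \<in> N g"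
    then show "commutator C u v \<in> (if Suc s = 0 then N g else M g (Suc s))"
      using commutator_N_N commutator_M_N by (auto split: if_splits)
  qed (simp_all add: N_subgroup M_subgroup)
  also have "M g c \<subseteq> {\<one>}"
    unfolding M_def by (rule generate_subgroup_incl[OF _ triv_subgroup]) (use g c in auto)
  then have "(if c = 0 then N g else M g c) \<subseteq> {\<one>}" using c0 by simp
  finally show ?thesis
    using subgroup.one_closed[OF group.lower_central_subgroup[OF subgroup_imp_group[OF N_subgroup]]]
    by auto
qed

end

section \<open>Orders of elements in \<open>D\<close> and in the whole group\<close>

context
  fixes p e n
  assumes p: "Factorial_Ring.prime p" and n: "n = p ^ e"
    and cl: "lower_central G (p - 1) = {\<one>\<^bsub>G\<^esub>}"
    and exp: "\<And>g. g \<in> carrier G \<Longrightarrow> g [^]\<^bsub>G\<^esub> n = \<one>\<^bsub>G\<^esub>"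
begin

text \<open>The commutator lies in \<open>N g\<close>, which has class at most \<open>p - 1\<close>
  and is generated by conjugates of \<open>l g\<close>, all of order dividing
  \<open>n\<close>.\<close>

lemma pow_generator_D:
  assumes g: "g \<in> carrier G" and h: "h \<in> carrier G"
  shows "commutator C (l g) (r h) [^] n = \<one>"
proof (rule exponent_generate_subgroup[OF p n N_gens_carrier[OF g]])
  show "commutator C (l g) (r h) \<in> generate C {conj_by (l g) (r x) | x. x \<in> carrier G}"
    using commutator_l_r_N[OF g h] by (simp add: N_def)
  show "lower_central (C\<lparr>carrier := generate C {conj_by (l g) (r x) | x. x \<in> carrier G}\<rparr>) (p - 1) = {\<one>}"
    using lower_central_N[OF g cl] prime_gt_1_nat[OF p] by (simp add: N_def)
  fix s assume "s \<in> {conj_by (l g) (r x) | x. x \<in> carrier G}"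
  then obtain x where "x \<in> carrier G" "s = conj_by (l g) (r x)" by blast
  moreover have "l g [^] n = \<one>" using l.hom_nat_pow[OF g, of n] exp[OF g] by simp
  ultimately show "s [^] n = \<one>" using g by (simp add: conj_by_pow)
qed

lemma pow_D:
  assumes "d \<in> D"
  shows "d [^] n = \<one>"
proof (rule exponent_generate_subgroup[OF p n generators_carrier])
  show "d \<in> generate C {commutator C x y | x y. x \<in> l ` carrier G \<and> y \<in> r ` carrier G}"
    using assms by (simp add: D_def commutator_subgroup_def)
  show "lower_central (C\<lparr>carrier := generate C {commutator C x y | x y.
      x \<in> l ` carrier G \<and> y \<in> r ` carrier G}\<rparr>) (p - 1) = {\<one>}"
    using lower_central_D[OF cl] prime_gt_1_nat[OF p] by (simp add: D_def commutator_subgroup_def)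
qed (use pow_generator_D in auto)

lemma pow_carrier: "x \<in> carrier C \<Longrightarrow> x [^] n\<^sup>2 = \<one>"
  using pow_D[OF pow_mod_D[OF _ exp]] by (simp add: nat_pow_pow power2_eq_square)

end

end

text \<open>The identity on both factors extends to the free product and kills the relators;
  factoring it through the quotient gives \<open>q\<close>.\<close>

lemma (in group) weak_commutativity_chi:
  obtains q where "weak_commutativity (chi G) G (chi_inl G) (chi_inr G) q"
proof -
  let ?F = "free_product G G" and ?K = "normal_closure (free_product G G) (chi_relators G)"
  interpret F: group ?F by (intro free_product_group group_axioms)
  interpret K: normal ?K ?F by (rule chi_kernel_normal)
  note inc = hom_in_carrier[OF fp_inl_hom[OF group_axioms group_axioms]]
    hom_in_carrier[OF fp_inr_hom[OF group_axioms group_axioms]]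
  interpret pi: group_hom ?F "chi G" "\<lambda>a. ?K #>\<^bsub>?F\<^esub> a"
    by (intro group_hom.intro group_hom_axioms.intro F.group_axioms chi_group)
      (simp add: chi_def K.r_coset_hom_Mod)
  have idh: "(\<lambda>x. x) \<in> hom G G" by (auto intro: homI)
  obtain h where h: "h \<in> hom ?F G"
    and hl: "\<And>x. x \<in> carrier G \<Longrightarrow> h (fp_inl G G x) = x"
    and hr: "\<And>x. x \<in> carrier G \<Longrightarrow> h (fp_inr G G x) = x"
    using free_product_lift[OF group_axioms group_axioms group_axioms idh idh] by auto
  interpret h: group_hom ?F G h by unfold_locales (rule h)
  have "chi_relators G \<subseteq> kernel ?F G h"
    using chi_relators_carrier
    by (auto simp: kernel_def chi_relators_def h.hom_commutator inc hl hr)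
  then have "?K \<subseteq> kernel ?F G h"
    unfolding normal_closure_def using h.normal_kernel by blast
  then obtain q where q: "q \<in> hom (?F Mod ?K) G"
    "\<And>x. x \<in> carrier ?F \<Longrightarrow> q (?K #>\<^bsub>?F\<^esub> x) = h x"
    using h.FactGroup_universal_kernel[OF chi_kernel_normal] by blast
  have "weak_commutativity (chi G) G (chi_inl G) (chi_inr G) q"
  proof (intro weak_commutativity.intro weak_commutativity_axioms.intro chi_group group_axioms
      chi_inl_hom chi_inr_hom)
    show "q \<in> hom (chi G) G" using q by (simp add: chi_def)
    fix g assume g: "g \<in> carrier G"
    show "q (chi_inl G g) = g" "q (chi_inr G g) = g"
      using g by (simp_all add: chi_inl_def chi_inr_def q inc hl hr)
    have "commutator ?F (fp_inl G G g) (fp_inr G G g) \<in> ?K"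
      using normal_closure_superset[of "chi_relators G" ?F] g by (auto simp: chi_relators_def)
    then have "?K #>\<^bsub>?F\<^esub> commutator ?F (fp_inl G G g) (fp_inr G G g) = \<one>\<^bsub>chi G\<^esub>"
      by (simp add: K.rcos_const chi_def FactGroup_def)
    then show "commutator (chi G) (chi_inl G g) (chi_inr G g) = \<one>\<^bsub>chi G\<^esub>"
      using g by (simp add: pi.hom_commutator inc chi_inl_def chi_inr_def)
  next
    let ?S = "fp_inl G G ` carrier G \<union> fp_inr G G ` carrier G"
    have "?S \<subseteq> carrier ?F" using inc by auto
    then have "generate (chi G) ((\<lambda>a. ?K #>\<^bsub>?F\<^esub> a) ` ?S) = (\<lambda>a. ?K #>\<^bsub>?F\<^esub> a) ` carrier ?F"
      by (subst free_product_generate[OF group_axioms group_axioms]) (rule pi.generate_img)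
    also have "\<dots> = carrier (chi G)" by (auto simp: chi_def FactGroup_def RCOSETS_def)
    also have "(\<lambda>a. ?K #>\<^bsub>?F\<^esub> a) ` ?S = chi_inl G ` carrier G \<union> chi_inr G ` carrier G"
      by (simp add: image_Un image_image chi_inl_def chi_inr_def)
    finally show "carrier (chi G) = generate (chi G) (chi_inl G ` carrier G \<union> chi_inr G ` carrier G)"
      by simp
  qed
  then show thesis by (rule that)
qed

theorem theorem1p2:
  fixes G :: "('a, 'm) monoid_scheme" and p :: nat
  assumes "Factorial_Ring.prime p"
    and "finite_p_group p G"
    and "nilpotent_group G"
    and "nilpotency_class G \<le> p - 1"
  shows "nilpotent_group (chi_D_group G)
    \<and> nilpotency_class (chi_D_group G) \<le> p - 1
    \<and> group_exponent (chi_D_group G) dvd group_exponent G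
    \<and> group_exponent (chi G) dvd (group_exponent G)\<^sup>2"
proof -
  interpret G: group G using assms(3) by (simp add: nilpotent_group_def)
  have fin: "finite (carrier G)" using assms(2) by (simp add: finite_p_group_def)
  obtain q where "weak_commutativity (chi G) G (chi_inl G) (chi_inr G) q"
    by (rule G.weak_commutativity_chi)
  then interpret W: weak_commutativity "chi G" G "chi_inl G" "chi_inr G" q .
  have D: "W.D = chi_D G" by (simp add: W.D_def chi_D_def)
  define n where "n = group_exponent G"
  have n0: "n > 0" using G.finite_group_exponent(1)[OF fin] by (simp add: n_def)
  have exp: "g [^]\<^bsub>G\<^esub> n = \<one>\<^bsub>G\<^esub>" if "g \<in> carrier G" for g
    using G.finite_group_exponent(3)[OF fin that] by (simp add: n_def)
  obtain k where "order G = p ^ k" using assms(2) by (auto simp: finite_p_group_def)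
  \<comment> \<open>A divisor of the order is itself a power of \<open>p\<close>, the form that the
    torsion results require.\<close>
  then have "n dvd p ^ k" using G.finite_group_exponent(2)[OF fin] by (simp add: n_def)
  then obtain e where n: "n = p ^ e" using assms(1) by (auto simp: divides_primepow_nat)
  have "\<exists>c. lower_central G c = {\<one>\<^bsub>G\<^esub>}" using assms(3) by (simp add: nilpotent_group_def)
  then have "lower_central G (nilpotency_class G) = {\<one>\<^bsub>G\<^esub>}"
    unfolding nilpotency_class_def by (rule LeastI_ex)
  then have cl: "lower_central G (p - 1) = {\<one>\<^bsub>G\<^esub>}"
    using G.lower_central_antimono[OF assms(4)] subgroup.one_closed[OF G.lower_central_subgroup]
    by blast
  have D_cl: "lower_central (chi_D_group G) (p - 1) = {\<one>\<^bsub>chi_D_group G\<^esub>}"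
    using W.lower_central_D[OF cl] prime_gt_1_nat[OF assms(1)] by (simp add: D chi_D_group_def)
  interpret DG: group "chi_D_group G" by (rule G.chi_D_group_group)
  have "group_exponent (chi_D_group G) dvd n"
    using W.pow_D[OF assms(1) n cl exp] n0
    by (intro DG.group_exponent_dvd) (auto simp: chi_D_group_def D W.nat_pow_consistent[symmetric])
  moreover have "group_exponent (chi G) dvd n\<^sup>2"
    using W.pow_carrier[OF assms(1) n cl exp] n0 by (intro W.group_exponent_dvd) auto
  moreover have "nilpotent_group (chi_D_group G)"
    unfolding nilpotent_group_def using D_cl DG.group_axioms by blast
  moreover have "nilpotency_class (chi_D_group G) \<le> p - 1"
    unfolding nilpotency_class_def using D_cl by (rule Least_le)
  ultimately show ?thesis by (simp add: n_def)
qed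

end
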